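(* Consider an invertible adapted bounded linear map $\Phi_u:\mathbb{R}^N\to\mathbb{R}^N$, represented by premultiplication by the matrix $[\mathbf{1}|(\phi^s_u)^*|(\phi'_u)^*]^*$, where $\mathbf{1}$ is a column of 1's, $\phi^s_u$ is an $M\times N$ matrix for some $0\le M\le N-1$, $\phi'_u$ is an $(N-M-1)\times N$ matrix, and $$\sum_{0\le u<t}\phi^s_u(\mathbb{X}_{u+1}-\mathbb{X}_u)$$ is a symmetric $\mathcal{SL}$-martingale. Then, for any $\mathcal{SL}$-martingale $X$, there exist unique adapted processes $Z^{(s)}$ (with values in $\mathbb{R}^M$) and $Z'$ (with values in $\mathbb{R}^{N-M-1}$) such that $$X_t=X_0+\sum_{0\le u<t}(Z^{(s)}_u)^*\phi^s_u(\mathbb{X}_{u+1}-\mathbb{X}_u)+\sum_{0\le u<t}(Z'_u)^*\phi'_u(\mathbb{X}_{u+1}-\mathbb{X}_u)-\sum_{0\le u<t}G_u(Z'_u),$$ where $G_t(Z'_t)=\mathcal{E}_t((Z'_t)^*\phi'_t(\mathbb{X}_{t+1}-\mathbb{X}_t))$.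
   Context: Finite-state setting. $\mathcal{X}=(\mathcal{X}_t)$ is a discrete-time process taking values in the standard basis vectors of $\mathbb{R}^N$, $\mathbb{X}_t=\sum_{u=1}^t\mathcal{X}_u$, and $\mathcal{F}_t=\sigma(\mathcal{X}_1,\dots,\mathcal{X}_t)$ ($\mathcal{F}_0$ trivial), $\mathcal{F}=\mathcal{F}_\infty=\sigma(\bigcup_t\mathcal{F}_t)$. $^*$ denotes transpose. $m\mathcal{F}_t$ denotes the $\mathcal{F}_t$-measurable $\mathbb{R}\cup\{\pm\infty\}$-valued functions. $\mathcal{H}$ is a linear space of $\mathcal{F}$-measurable $\mathbb{R}$-valued functions on $\Omega$ containing the constants, with $|X|\in\mathcal{H}$ and $I_AX\in\mathcal{H}$ whenever $X\in\mathcal{H}$, $A\in\mathcal{F}$; $\mathcal{H}_t=\mathcal{H}\cap m\mathcal{F}_t$. $\mathcal{E}$ is an $\mathcal{SL}$-expectation: a family of maps $\mathcal{E}_t:\mathcal{H}\to\mathcal{H}_t$ such that for all $X,Y\in\mathcal{H}$, $s\le t$: (i) $X\ge Y$ implies $\mathcal{E}_t(X)\ge\mathcal{E}_t(Y)$; (ii) $\mathcal{E}_s(Y)=\mathcal{E}_s(\mathcal{E}_t(Y))$; (iii) $\mathcal{E}_t(I_AY)=I_A\mathcal{E}_t(Y)$ for $A\in\mathcal{F}_t$; (iv) $\mathcal{E}_t(Y)=Y$ for $Y\in\mathcal{H}_t$; (v) $\mathcal{E}_t(X+Y)\le\mathcal{E}_t(X)+\mathcal{E}_t(Y)$; (vi)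 $\mathcal{E}_t(\lambda Y)=\lambda^+\mathcal{E}_t(Y)+\lambda^-\mathcal{E}_t(-Y)$ for $\lambda\in\mathcal{H}_t$ with $\lambda Y\in\mathcal{H}$; (vii) if $X_i\in\mathcal{H}$ and $X_i(\omega)\downarrow0$ for every $\omega$, then $\mathcal{E}_0(X_i)\to0$. Write $\mathcal{E}=\mathcal{E}_0$. $L^1$ is the completion of $\{X\in\mathcal{H}:\mathcal{E}(|X|)<\infty\}$ under $\|X\|_1=\mathcal{E}(|X|)$ (modulo equality in $\|\cdot\|_1$), and $\mathcal{E}_t$ extends to $L^1$ by continuity. An $\mathcal{SL}$-martingale is a process with $X_t\in L^1\cap m\mathcal{F}_t$ for all $t$ and $X_s=\mathcal{E}_s(X_t)$ for all $s\le t$; it is symmetric if $\mathcal{E}_s(X_t)=-\mathcal{E}_s(-X_t)$ for all $s,t$ (componentwise for vector-valued processes).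
   Formalization: Literal uniqueness of Z^(s), Z' fails if some states are unreachable; the formal claim is quasi-sure uniqueness where all N states have positive conditional capacity, and in general only of differences of (Z^(s))^*φ^s+(Z')^*φ' between reachable states. *)

theory Defs
  imports "HOL-Analysis.Analysis" "Jordan_Normal_Form.Matrix"
begin

unbundle no vec_syntax and no inner_syntax

text \<open>
  Vectors and matrices are those of \<^theory>\<open>Jordan_Normal_Form.Matrix\<close>, whose dimensions are
  natural numbers and may be 0: both extreme cases, a block of 0 rows above or below, occur.
  The sample space is the whole type \<open>'w\<close>; the states are the basis vectors \<open>unit_vec N i\<close>
  with \<open>i < N\<close>. The process \<open>\<X>\<close> is indexed by times \<open>1, 2, ...\<close>; the value at 0 is never used.
\<close>

definition filt :: "(nat \<Rightarrow> 'w \<Rightarrow> real vec) \<Rightarrow> nat \<Rightarrow> 'w measure" where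
  "filt \<X> t = sigma UNIV {\<X> u -` {v} | u v. u \<in> {1..t}}"

definition filt_inf :: "(nat \<Rightarrow> 'w \<Rightarrow> real vec) \<Rightarrow> 'w measure" where
  "filt_inf \<X> = sigma UNIV (\<Union>t. sets (filt \<X> t))"

definition cumul :: "nat \<Rightarrow> (nat \<Rightarrow> 'w \<Rightarrow> real vec) \<Rightarrow> nat \<Rightarrow> 'w \<Rightarrow> real vec" where
  "cumul N \<X> t \<omega> = vec N (\<lambda>i. \<Sum>u\<in>{1..t}. \<X> u \<omega> $ i)"

locale SL_expectation =
  fixes N :: nat
    and \<X> :: "nat \<Rightarrow> 'w \<Rightarrow> real vec"
    and H :: "('w \<Rightarrow> real) set"
    and E :: "nat \<Rightarrow> ('w \<Rightarrow> real) \<Rightarrow> 'w \<Rightarrow> real"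
  assumes state: "1 \<le> t \<Longrightarrow> \<exists>i<N. \<X> t \<omega> = unit_vec N i"
    and H_measurable: "H \<subseteq> borel_measurable (filt_inf \<X>)"
    and H_const: "(\<lambda>_. c) \<in> H"
    and H_add: "X \<in> H \<Longrightarrow> Y \<in> H \<Longrightarrow> (\<lambda>\<omega>. X \<omega> + Y \<omega>) \<in> H"
    and H_scale: "X \<in> H \<Longrightarrow> (\<lambda>\<omega>. c * X \<omega>) \<in> H"
    and H_abs: "X \<in> H \<Longrightarrow> (\<lambda>\<omega>. \<bar>X \<omega>\<bar>) \<in> H"
    and H_indicator: "X \<in> H \<Longrightarrow> A \<in> sets (filt_inf \<X>) \<Longrightarrow> (\<lambda>\<omega>. indicator A \<omega> * X \<omega>) \<in> H"
    and E_range: "X \<in> H \<Longrightarrow> E t X \<in> H \<inter> borel_measurable (filt \<X> t)"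
    and E_mono: "X \<in> H \<Longrightarrow> Y \<in> H \<Longrightarrow> (\<And>\<omega>. Y \<omega> \<le> X \<omega>) \<Longrightarrow> E t Y \<omega> \<le> E t X \<omega>"
    and E_tower: "Y \<in> H \<Longrightarrow> s \<le> t \<Longrightarrow> E s Y = E s (E t Y)"
    and E_indicator: "Y \<in> H \<Longrightarrow> A \<in> sets (filt \<X> t) \<Longrightarrow>
          E t (\<lambda>\<omega>. indicator A \<omega> * Y \<omega>) = (\<lambda>\<omega>. indicator A \<omega> * E t Y \<omega>)"
    and E_id: "Y \<in> H \<inter> borel_measurable (filt \<X> t) \<Longrightarrow> E t Y = Y"
    and E_subadd: "X \<in> H \<Longrightarrow> Y \<in> H \<Longrightarrow> E t (\<lambda>\<omega>. X \<omega> + Y \<omega>) \<omega> \<le> E t X \<omega> + E t Y \<omega>"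
    and E_scale: "l \<in> H \<inter> borel_measurable (filt \<X> t) \<Longrightarrow> Y \<in> H \<Longrightarrow> (\<lambda>\<omega>. l \<omega> * Y \<omega>) \<in> H \<Longrightarrow>
          E t (\<lambda>\<omega>. l \<omega> * Y \<omega>) \<omega> =
            max (l \<omega>) 0 * E t Y \<omega> + max (- l \<omega>) 0 * E t (\<lambda>\<omega>. - Y \<omega>) \<omega>"
    and E_continuous: "(\<And>i::nat. Xs i \<in> H) \<Longrightarrow> (\<And>\<omega>. decseq (\<lambda>i. Xs i \<omega>)) \<Longrightarrow>
          (\<And>\<omega>. (\<lambda>i. Xs i \<omega>) \<longlonglongrightarrow> 0) \<Longrightarrow> (\<lambda>i. E 0 (Xs i) \<omega>) \<longlonglongrightarrow> 0"

text \<open>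
  \<open>filt \<X> 0\<close> is trivial, so \<open>E 0 X\<close> is a constant function; \<open>expect E X\<close> is its value.
\<close>

definition expect :: "(nat \<Rightarrow> ('w \<Rightarrow> real) \<Rightarrow> 'w \<Rightarrow> real) \<Rightarrow> ('w \<Rightarrow> real) \<Rightarrow> real" where
  "expect E X = (THE c. E 0 X = (\<lambda>_. c))"

definition norm1 :: "(nat \<Rightarrow> ('w \<Rightarrow> real) \<Rightarrow> 'w \<Rightarrow> real) \<Rightarrow> ('w \<Rightarrow> real) \<Rightarrow> real" where
  "norm1 E X = expect E (\<lambda>\<omega>. \<bar>X \<omega>\<bar>)"

definition quasi_surely ::
  "(nat \<Rightarrow> 'w \<Rightarrow> real vec) \<Rightarrow> (nat \<Rightarrow> ('w \<Rightarrow> real) \<Rightarrow> 'w \<Rightarrow> real) \<Rightarrow> ('w \<Rightarrow> bool) \<Rightarrow> bool" where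
  "quasi_surely \<X> E P \<longleftrightarrow>
     (\<exists>A\<in>sets (filt_inf \<X>). expect E (indicator A) = 0 \<and> (\<forall>\<omega>. \<omega> \<notin> A \<longrightarrow> P \<omega>))"

text \<open>
  The completion of \<open>H\<close> under \<open>norm1\<close>: equivalence classes of \<open>norm1\<close>-Cauchy sequences.
  Every \<open>X \<in> H\<close> has a real-valued \<open>E 0 \<bar>X\<bar>\<close>, so the restriction to finite norm is void.
\<close>

type_synonym 'w L1_class = "(nat \<Rightarrow> 'w \<Rightarrow> real) set"

definition L1_Cauchy ::
  "('w \<Rightarrow> real) set \<Rightarrow> (nat \<Rightarrow> ('w \<Rightarrow> real) \<Rightarrow> 'w \<Rightarrow> real) \<Rightarrow> (nat \<Rightarrow> 'w \<Rightarrow> real) set" where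
  "L1_Cauchy H E = {S. (\<forall>n. S n \<in> H) \<and>
     (\<forall>e>0. \<exists>K. \<forall>m\<ge>K. \<forall>n\<ge>K. norm1 E (\<lambda>\<omega>. S m \<omega> - S n \<omega>) < e)}"

definition L1_rel ::
  "('w \<Rightarrow> real) set \<Rightarrow> (nat \<Rightarrow> ('w \<Rightarrow> real) \<Rightarrow> 'w \<Rightarrow> real) \<Rightarrow> (nat \<Rightarrow> 'w \<Rightarrow> real) rel" where
  "L1_rel H E = {(S, T). S \<in> L1_Cauchy H E \<and> T \<in> L1_Cauchy H E \<and>
     (\<lambda>n. norm1 E (\<lambda>\<omega>. S n \<omega> - T n \<omega>)) \<longlonglongrightarrow> 0}"

definition L1 ::
  "('w \<Rightarrow> real) set \<Rightarrow> (nat \<Rightarrow> ('w \<Rightarrow> real) \<Rightarrow> 'w \<Rightarrow> real) \<Rightarrow> 'w L1_class set" where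
  "L1 H E = L1_Cauchy H E // L1_rel H E"

definition L1_of ::
  "('w \<Rightarrow> real) set \<Rightarrow> (nat \<Rightarrow> ('w \<Rightarrow> real) \<Rightarrow> 'w \<Rightarrow> real) \<Rightarrow> ('w \<Rightarrow> real) \<Rightarrow> 'w L1_class" where
  "L1_of H E X = L1_rel H E `` {\<lambda>_. X}"

definition L1_plus ::
  "('w \<Rightarrow> real) set \<Rightarrow> (nat \<Rightarrow> ('w \<Rightarrow> real) \<Rightarrow> 'w \<Rightarrow> real) \<Rightarrow>
     'w L1_class \<Rightarrow> 'w L1_class \<Rightarrow> 'w L1_class" where
  "L1_plus H E a b = (\<Union>S\<in>a. \<Union>T\<in>b. L1_rel H E `` {\<lambda>n \<omega>. S n \<omega> + T n \<omega>})"

definition L1_uminus ::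
  "('w \<Rightarrow> real) set \<Rightarrow> (nat \<Rightarrow> ('w \<Rightarrow> real) \<Rightarrow> 'w \<Rightarrow> real) \<Rightarrow> 'w L1_class \<Rightarrow> 'w L1_class" where
  "L1_uminus H E a = (\<Union>S\<in>a. L1_rel H E `` {\<lambda>n \<omega>. - S n \<omega>})"

text \<open>
  The continuous extension of \<open>E t\<close> sends the limit of a Cauchy sequence \<open>S n\<close> to the limit of
  \<open>E t (S n)\<close>.
\<close>

definition E_L1 ::
  "('w \<Rightarrow> real) set \<Rightarrow> (nat \<Rightarrow> ('w \<Rightarrow> real) \<Rightarrow> 'w \<Rightarrow> real) \<Rightarrow> nat \<Rightarrow>
     'w L1_class \<Rightarrow> 'w L1_class" where
  "E_L1 H E t a = (\<Union>S\<in>a. L1_rel H E `` {\<lambda>n. E t (S n)})"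

text \<open>
  The intersection of \<open>L\<^sup>1\<close> with the extended-real-valued \<open>filt \<X> t\<close>-measurable functions. A
  function \<open>f\<close> is identified with an element of the completion if some Cauchy sequence representing
  that element converges to \<open>f\<close> outside a set of capacity zero.
\<close>

definition L1_measurable ::
  "(nat \<Rightarrow> 'w \<Rightarrow> real vec) \<Rightarrow> ('w \<Rightarrow> real) set \<Rightarrow> (nat \<Rightarrow> ('w \<Rightarrow> real) \<Rightarrow> 'w \<Rightarrow> real) \<Rightarrow>
     nat \<Rightarrow> 'w L1_class set" where
  "L1_measurable \<X> H E t = {a \<in> L1 H E. \<exists>f :: 'w \<Rightarrow> ereal. f \<in> borel_measurable (filt \<X> t) \<and>
     (\<exists>S\<in>a. quasi_surely \<X> E (\<lambda>\<omega>. (\<lambda>n. ereal (S n \<omega>)) \<longlonglongrightarrow> f \<omega>))}"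

definition SL_martingale ::
  "(nat \<Rightarrow> 'w \<Rightarrow> real vec) \<Rightarrow> ('w \<Rightarrow> real) set \<Rightarrow> (nat \<Rightarrow> ('w \<Rightarrow> real) \<Rightarrow> 'w \<Rightarrow> real) \<Rightarrow>
     (nat \<Rightarrow> 'w L1_class) \<Rightarrow> bool" where
  "SL_martingale \<X> H E X \<longleftrightarrow>
     (\<forall>t. X t \<in> L1_measurable \<X> H E t) \<and> (\<forall>s t. s \<le> t \<longrightarrow> X s = E_L1 H E s (X t))"

definition symmetric_SL_martingale ::
  "(nat \<Rightarrow> 'w \<Rightarrow> real vec) \<Rightarrow> ('w \<Rightarrow> real) set \<Rightarrow> (nat \<Rightarrow> ('w \<Rightarrow> real) \<Rightarrow> 'w \<Rightarrow> real) \<Rightarrow>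
     (nat \<Rightarrow> 'w L1_class) \<Rightarrow> bool" where
  "symmetric_SL_martingale \<X> H E X \<longleftrightarrow> SL_martingale \<X> H E X \<and>
     (\<forall>s t. E_L1 H E s (X t) = L1_uminus H E (E_L1 H E s (L1_uminus H E (X t))))"

definition adapted_vec ::
  "(nat \<Rightarrow> 'w \<Rightarrow> real vec) \<Rightarrow> nat \<Rightarrow> (nat \<Rightarrow> 'w \<Rightarrow> real vec) \<Rightarrow> bool" where
  "adapted_vec \<X> n Z \<longleftrightarrow> (\<forall>u. (\<forall>\<omega>. Z u \<omega> \<in> carrier_vec n) \<and>
     (\<forall>i<n. (\<lambda>\<omega>. Z u \<omega> $ i) \<in> borel_measurable (filt \<X> u)))"

definition adapted_mat ::
  "(nat \<Rightarrow> 'w \<Rightarrow> real vec) \<Rightarrow> nat \<Rightarrow> nat \<Rightarrow> (nat \<Rightarrow> 'w \<Rightarrow> real mat) \<Rightarrow> bool" where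
  "adapted_mat \<X> m n A \<longleftrightarrow> (\<forall>u. (\<forall>\<omega>. A u \<omega> \<in> carrier_mat m n) \<and>
     (\<forall>i<m. \<forall>j<n. (\<lambda>\<omega>. A u \<omega> $$ (i, j)) \<in> borel_measurable (filt \<X> u)))"

text \<open>\<open>increment N \<X> A u\<close> is the random vector \<open>A\<^sub>u (cumul (u+1) - cumul u)\<close>.\<close>

definition increment ::
  "nat \<Rightarrow> (nat \<Rightarrow> 'w \<Rightarrow> real vec) \<Rightarrow> (nat \<Rightarrow> 'w \<Rightarrow> real mat) \<Rightarrow> nat \<Rightarrow> 'w \<Rightarrow> real vec" where
  "increment N \<X> A u \<omega> = A u \<omega> *\<^sub>v (cumul N \<X> (Suc u) \<omega> - cumul N \<X> u \<omega>)"

definition driver ::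
  "nat \<Rightarrow> (nat \<Rightarrow> 'w \<Rightarrow> real vec) \<Rightarrow> (nat \<Rightarrow> ('w \<Rightarrow> real) \<Rightarrow> 'w \<Rightarrow> real) \<Rightarrow>
     (nat \<Rightarrow> 'w \<Rightarrow> real mat) \<Rightarrow> nat \<Rightarrow> ('w \<Rightarrow> real vec) \<Rightarrow> 'w \<Rightarrow> real" where
  "driver N \<X> E \<phi>' t z = E t (\<lambda>\<omega>. z \<omega> \<bullet> increment N \<X> \<phi>' t \<omega>)"

definition represents ::
  "nat \<Rightarrow> nat \<Rightarrow> (nat \<Rightarrow> 'w \<Rightarrow> real vec) \<Rightarrow> ('w \<Rightarrow> real) set \<Rightarrow>
     (nat \<Rightarrow> ('w \<Rightarrow> real) \<Rightarrow> 'w \<Rightarrow> real) \<Rightarrow> (nat \<Rightarrow> 'w \<Rightarrow> real mat) \<Rightarrow> (nat \<Rightarrow> 'w \<Rightarrow> real mat) \<Rightarrow>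
     (nat \<Rightarrow> 'w L1_class) \<Rightarrow> (nat \<Rightarrow> 'w \<Rightarrow> real vec) \<Rightarrow> (nat \<Rightarrow> 'w \<Rightarrow> real vec) \<Rightarrow> bool" where
  "represents N M \<X> H E \<phi>s \<phi>' X Zs Z' \<longleftrightarrow>
     adapted_vec \<X> M Zs \<and> adapted_vec \<X> (N - M - 1) Z' \<and>
     (\<forall>t. X t = L1_plus H E (X 0) (L1_of H E (\<lambda>\<omega>.
          (\<Sum>u<t. Zs u \<omega> \<bullet> increment N \<X> \<phi>s u \<omega>)
        + (\<Sum>u<t. Z' u \<omega> \<bullet> increment N \<X> \<phi>' u \<omega>)
        - (\<Sum>u<t. driver N \<X> E \<phi>' u (Z' u) \<omega>))))"

text \<open>
  The states \<open>i\<close> to which \<open>\<X>\<close> can move next, i.e. those of positive conditional capacity.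
\<close>

definition next_states ::
  "nat \<Rightarrow> (nat \<Rightarrow> 'w \<Rightarrow> real vec) \<Rightarrow> (nat \<Rightarrow> ('w \<Rightarrow> real) \<Rightarrow> 'w \<Rightarrow> real) \<Rightarrow>
     nat \<Rightarrow> 'w \<Rightarrow> nat set" where
  "next_states N \<X> E u \<omega> =
     {i. i < N \<and> 0 < E u (indicator {\<omega>'. \<X> (Suc u) \<omega>' = unit_vec N i}) \<omega>}"

text \<open>
  The row vector \<open>(Zs)\<^sup>* \<phi>s + (Z')\<^sup>* \<phi>'\<close> evaluated at the state \<open>i\<close>.
\<close>

definition integrand ::
  "nat \<Rightarrow> real mat \<Rightarrow> real mat \<Rightarrow> real vec \<Rightarrow> real vec \<Rightarrow> nat \<Rightarrow> real" where
  "integrand N A B zs z' i = zs \<bullet> (A *\<^sub>v unit_vec N i) + z' \<bullet> (B *\<^sub>v unit_vec N i)"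

text \<open>
  Uniqueness of \<open>(Zs, Z')\<close>. The values on states which \<open>\<X>\<close> cannot reach, and an additive constant
  (it is compensated by the driver), do not affect the represented process. Hence two pairs agree
  when, quasi-surely at each time, they coincide if all \<open>N\<close> states are reachable, and otherwise
  have integrands with the same differences between any two reachable states.
\<close>

definition agree ::
  "nat \<Rightarrow> (nat \<Rightarrow> 'w \<Rightarrow> real vec) \<Rightarrow> (nat \<Rightarrow> ('w \<Rightarrow> real) \<Rightarrow> 'w \<Rightarrow> real) \<Rightarrow>
     (nat \<Rightarrow> 'w \<Rightarrow> real mat) \<Rightarrow> (nat \<Rightarrow> 'w \<Rightarrow> real mat) \<Rightarrow>
     (nat \<Rightarrow> 'w \<Rightarrow> real vec) \<Rightarrow> (nat \<Rightarrow> 'w \<Rightarrow> real vec) \<Rightarrow>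
     (nat \<Rightarrow> 'w \<Rightarrow> real vec) \<Rightarrow> (nat \<Rightarrow> 'w \<Rightarrow> real vec) \<Rightarrow> bool" where
  "agree N \<X> E \<phi>s \<phi>' Zs Z' Ws W' \<longleftrightarrow> (\<forall>u. quasi_surely \<X> E (\<lambda>\<omega>.
     (next_states N \<X> E u \<omega> = {..<N} \<longrightarrow> Zs u \<omega> = Ws u \<omega> \<and> Z' u \<omega> = W' u \<omega>) \<and>
     (\<forall>i\<in>next_states N \<X> E u \<omega>. \<forall>j\<in>next_states N \<X> E u \<omega>.
        integrand N (\<phi>s u \<omega>) (\<phi>' u \<omega>) (Zs u \<omega>) (Z' u \<omega>) i
          - integrand N (\<phi>s u \<omega>) (\<phi>' u \<omega>) (Zs u \<omega>) (Z' u \<omega>) j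
        = integrand N (\<phi>s u \<omega>) (\<phi>' u \<omega>) (Ws u \<omega>) (W' u \<omega>) i
          - integrand N (\<phi>s u \<omega>) (\<phi>' u \<omega>) (Ws u \<omega>) (W' u \<omega>) j)))"

end

theory Submission
  imports Defs
begin

text \<open>
  Each \<open>filt \<X> t\<close> is a finite \<open>\<sigma>\<close>-algebra, whose measurable functions are the functions of the path
  up to time \<open>t\<close>. By continuity of \<open>E 0\<close> along sequences decreasing to 0, an Egorov argument shows that
  an element of \<open>L\<^sup>1\<close> with a \<open>filt \<X> t\<close>-measurable version is the class of a real-valued
  function \<open>g t\<close> of that path, so everything reduces to quasi-sure identities between such functions.

  Given the past, \<open>g (t+1)\<close> is a linear form in the next state. Expanding it in the rows of the
  invertible matrix \<open>\<Phi>\<close> gives a constant, a combination of \<open>\<phi>s\<close> and a combination of \<open>\<phi>'\<close>; the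
  conditional expectation sees only the constant and, since the \<open>\<phi>s\<close>-part is symmetric, the driver.
  Subtracting it yields the increment of the martingale. Conversely, two representations have
  quasi-surely equal increments, and conditioning the modulus of their difference forces it to vanish
  on every reachable next state.
\<close>

section \<open>Linear algebra of a block matrix whose top row consists of ones\<close>

lemma mult_block_rows_unit_vec:
  fixes A B :: "real mat"
  assumes "M < N" "A \<in> carrier_mat M N" "B \<in> carrier_mat (N - M - 1) N"
    and "zs \<in> carrier_vec M" "z' \<in> carrier_vec (N - M - 1)" "i < N"
  shows "(vec 1 (\<lambda>_. y0) @\<^sub>v zs @\<^sub>v z') \<bullet>
      ((mat_of_row (vec N (\<lambda>_. 1)) @\<^sub>r A @\<^sub>r B) *\<^sub>v unit_vec N i)
    = y0 + integrand N A B zs z' i"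
proof -
  let ?e = "unit_vec N i :: real vec"
  have one: "vec 1 (\<lambda>_. y0) \<bullet> (mat_of_row (vec N (\<lambda>_. 1)) *\<^sub>v ?e) = y0"
    using assms(6) by (simp add: scalar_prod_def mult_mat_vec_def)
  \<comment> \<open>The product is split twice: first the row of ones from the two lower blocks,
    which together have \<open>M + (N - M - 1)\<close> rows, then \<open>A\<close> from
    \<open>B\<close>.\<close>
  have "(mat_of_row (vec N (\<lambda>_. 1)) @\<^sub>r A @\<^sub>r B) *\<^sub>v ?e
      = (mat_of_row (vec N (\<lambda>_. 1)) *\<^sub>v ?e) @\<^sub>v (A *\<^sub>v ?e) @\<^sub>v (B *\<^sub>v ?e)"
    using assms carrier_append_rows[OF assms(2,3)]
    by (subst mat_mult_append[of _ 1 N _ "M + (N - M - 1)"])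
      (simp_all add: mat_mult_append[of A M N B "N - M - 1"])
  moreover have c: "A *\<^sub>v ?e \<in> carrier_vec M" "B *\<^sub>v ?e \<in> carrier_vec (N - M - 1)"
      "mat_of_row (vec N (\<lambda>_. 1)) *\<^sub>v ?e \<in> carrier_vec 1"
    using assms by (auto intro!: mult_mat_vec_carrier)
  moreover have "zs @\<^sub>v z' \<in> carrier_vec (M + (N - M - 1))"
      "(A *\<^sub>v ?e) @\<^sub>v (B *\<^sub>v ?e) \<in> carrier_vec (M + (N - M - 1))"
    by (intro append_carrier_vec assms c)+
  ultimately show ?thesis
    using one assms(4,5)
    by (simp add: integrand_def scalar_prod_append[of _ 1 _ "M + (N - M - 1)"]
        scalar_prod_append[of _ M _ "N - M - 1"] del: One_nat_def)
qed

lemma split_vec3: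
  fixes y :: "real vec"
  assumes "M < N" "y \<in> carrier_vec N"
  shows "y = vec 1 (\<lambda>_. y $ 0) @\<^sub>v vec M (\<lambda>i. y $ (i + 1)) @\<^sub>v vec (N - M - 1) (\<lambda>i. y $ (i + M + 1))"
  using assms by (intro eq_vecI) auto

lemma invertible_mat_carrierE:
  fixes P :: "real mat"
  assumes "invertible_mat P" "P \<in> carrier_mat N N"
  obtains Q where "Q \<in> carrier_mat N N" "P * Q = 1\<^sub>m N" "Q * P = 1\<^sub>m N"
proof -
  from assms(1) obtain Q where Q: "inverts_mat P Q" "inverts_mat Q P"
    unfolding invertible_mat_def by auto
  have PQ: "P * Q = 1\<^sub>m N" and QP: "Q * P = 1\<^sub>m (dim_row Q)"
    using Q assms(2) unfolding inverts_mat_def by auto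
  \<comment> \<open>The shape of the inverse is not part of \<open>invertible_mat\<close>; it is
    read off from the sizes of the two identity matrices.\<close>
  have "dim_col (P * Q) = N" "dim_col (Q * P) = dim_row Q"
    using PQ QP by simp_all
  then have "Q \<in> carrier_mat N N" using assms(2) by auto
  with PQ QP show thesis by (auto intro: that)
qed

text \<open>With \<open>Q\<close> the inverse of the block matrix \<open>P\<close>, the vector of
  coefficients is the transpose of \<open>Q\<close> applied to \<open>c\<close>: moving
  \<open>Q\<close> across the scalar product leaves \<open>Q * P\<close>, the identity. The
  coefficient of the row of ones is the constant \<open>y0\<close>.\<close>

lemma block_rows_solvable:
  fixes A B :: "real mat" and c :: "nat \<Rightarrow> real"
  assumes "M < N" "A \<in> carrier_mat M N" "B \<in> carrier_mat (N - M - 1) N"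
    and inv: "invertible_mat (mat_of_row (vec N (\<lambda>_. 1)) @\<^sub>r A @\<^sub>r B)"
  shows "\<exists>y0 zs z'. zs \<in> carrier_vec M \<and> z' \<in> carrier_vec (N - M - 1) \<and>
    (\<forall>i<N. c i = y0 + integrand N A B zs z' i)"
proof -
  let ?P = "mat_of_row (vec N (\<lambda>_. 1)) @\<^sub>r A @\<^sub>r B"
  have P: "?P \<in> carrier_mat N N"
    using assms by (intro carrier_matI) (auto simp: append_rows_def)
  obtain Q where Q: "Q \<in> carrier_mat N N" "Q * ?P = 1\<^sub>m N"
    using invertible_mat_carrierE[OF inv P] by blast
  define y where "y = transpose_mat Q *\<^sub>v vec N c"
  have y: "y \<in> carrier_vec N" using Q unfolding y_def by auto
  define zs where "zs = vec M (\<lambda>i. y $ (i + 1))"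
  define z' where "z' = vec (N - M - 1) (\<lambda>i. y $ (i + M + 1))"
  have z: "zs \<in> carrier_vec M" "z' \<in> carrier_vec (N - M - 1)" unfolding zs_def z'_def by auto
  have "c i = y $ 0 + integrand N A B zs z' i" if "i < N" for i
  proof -
    have "y $ 0 + integrand N A B zs z' i = y \<bullet> (?P *\<^sub>v unit_vec N i)"
      using mult_block_rows_unit_vec[OF assms(1-3) z that, of "y $ 0"] split_vec3[OF assms(1) y]
      unfolding zs_def z'_def by metis
    also have "\<dots> = vec N c \<bullet> (Q *\<^sub>v (?P *\<^sub>v unit_vec N i))"
      unfolding y_def using Q P by (intro transpose_vec_mult_scalar) auto
    also have "Q *\<^sub>v (?P *\<^sub>v unit_vec N i) = (Q * ?P) *\<^sub>v unit_vec N i"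
      using Q(1) P by simp
    also have "\<dots> = unit_vec N i" unfolding Q(2) by simp
    finally show ?thesis using that by simp
  qed
  with z show ?thesis by blast
qed

text \<open>The hypothesis says that the transposed block matrix takes the same value at the two
  stacked coefficient vectors, and that matrix has a left inverse. The constants are themselves
  coefficients, those of the row of ones, so they may be different a priori; this allows two
  different drivers to stand in their place.\<close>

lemma block_rows_unique:
  fixes A B :: "real mat"
  assumes "M < N" "A \<in> carrier_mat M N" "B \<in> carrier_mat (N - M - 1) N"
    and inv: "invertible_mat (mat_of_row (vec N (\<lambda>_. 1)) @\<^sub>r A @\<^sub>r B)"
    and z: "zs \<in> carrier_vec M" "z' \<in> carrier_vec (N - M - 1)"
    and w: "ws \<in> carrier_vec M" "w' \<in> carrier_vec (N - M - 1)"
    and eq: "\<And>i. i < N \<Longrightarrow> y0 + integrand N A B zs z' i = x0 + integrand N A B ws w' i"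
  shows "zs = ws \<and> z' = w'"
proof -
  let ?P = "mat_of_row (vec N (\<lambda>_. 1)) @\<^sub>r A @\<^sub>r B"
  have P: "?P \<in> carrier_mat N N"
    using assms by (intro carrier_matI) (auto simp: append_rows_def)
  obtain Q where Q: "Q \<in> carrier_mat N N" "?P * Q = 1\<^sub>m N"
    using invertible_mat_carrierE[OF inv P] by blast
  define y where "y = vec 1 (\<lambda>_. y0) @\<^sub>v zs @\<^sub>v z'"
  define x where "x = vec 1 (\<lambda>_. x0) @\<^sub>v ws @\<^sub>v w'"
  have yx: "y \<in> carrier_vec N" "x \<in> carrier_vec N"
    using assms unfolding y_def x_def by (auto intro!: carrier_vecI)
  have left: "transpose_mat ?P *\<^sub>v y = transpose_mat ?P *\<^sub>v x"
  proof (rule eq_vecI)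
    fix i assume "i < dim_vec (transpose_mat ?P *\<^sub>v x)"
    then have i: "i < N" using P by simp
    have *: "(transpose_mat ?P *\<^sub>v v) $ i = v \<bullet> (?P *\<^sub>v unit_vec N i)" if "v \<in> carrier_vec N" for v
      using transpose_vec_mult_scalar[OF P _ that, of "unit_vec N i"] that i P by simp
    show "(transpose_mat ?P *\<^sub>v y) $ i = (transpose_mat ?P *\<^sub>v x) $ i"
      unfolding *[OF yx(1)] *[OF yx(2)] unfolding y_def x_def
      using mult_block_rows_unit_vec[OF assms(1-3) z i, of y0]
        mult_block_rows_unit_vec[OF assms(1-3) w i, of x0] eq[OF i] by metis
  qed simp
  have "transpose_mat Q * transpose_mat ?P = 1\<^sub>m N"
    using transpose_mult[OF P Q(1)] Q(2) by simp
  then have QP: "transpose_mat Q *\<^sub>v (transpose_mat ?P *\<^sub>v v) = v" if "v \<in> carrier_vec N" for v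
    using Q(1) P that
    by (metis assoc_mult_mat_vec one_mult_mat_vec transpose_carrier_mat)
  have "y = x" using left QP yx by metis
  then show ?thesis
    unfolding y_def x_def using z w by (simp add: append_vec_eq)
qed

text \<open>The increment of \<open>cumul\<close> is the next value of \<X> itself, so both products
  are read off at one column of the matrices.\<close>

lemma integrand_cong_unit_vec:
  assumes "\<X> (Suc u) \<omega> = unit_vec N i" "i < N"
  shows "zs \<bullet> increment N \<X> A u \<omega> + z' \<bullet> increment N \<X> B u \<omega> = integrand N (A u \<omega>) (B u \<omega>) zs z' i"
proof -
  have "cumul N \<X> (Suc u) \<omega> - cumul N \<X> u \<omega> = unit_vec N i"
    using assms by (intro eq_vecI) (auto simp: cumul_def)
  then show ?thesis by (simp add: increment_def integrand_def)
qed

section \<open>The filtration described by finite paths\<close>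

context SL_expectation
begin

text \<open>The fibres of \<open>path t\<close> are the atoms of \<open>filt \<X> t\<close>. Times
  start at 1, so \<open>path 0\<close> is always empty, in accordance with the triviality of
  \<open>filt \<X> 0\<close>.\<close>

definition path :: "nat \<Rightarrow> 'w \<Rightarrow> real vec list" where
  "path t \<omega> = map (\<lambda>v. \<X> v \<omega>) [1..<Suc t]"

lemma path_Suc: "path (Suc t) \<omega> = path t \<omega> @ [\<X> (Suc t) \<omega>]"
  by (simp add: path_def)

lemma path_eq_iff: "path t \<omega> = path t \<omega>' \<longleftrightarrow> (\<forall>v\<in>{1..t}. \<X> v \<omega> = \<X> v \<omega>')"
  by (auto simp: path_def)

lemma path_eq_le: "path t \<omega> = path t \<omega>' \<Longrightarrow> s \<le> t \<Longrightarrow> path s \<omega> = path s \<omega>'"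
  unfolding path_eq_iff by auto

lemma finite_range_path: "finite (range (path t))"
proof (rule finite_subset)
  show "range (path t) \<subseteq> {xs. set xs \<subseteq> unit_vec N ` {..<N} \<and> length xs = t}"
    using state by (fastforce simp: path_def)
qed (auto intro: finite_lists_length_eq)

lemma space_filt [simp]: "space (filt \<X> t) = UNIV"
  by (simp add: filt_def space_measure_of_conv)

lemma space_filt_inf [simp]: "space (filt_inf \<X>) = UNIV"
  by (simp add: filt_inf_def space_measure_of_conv)

lemma sets_filt_sigma: "sets (filt \<X> t) = sigma_sets UNIV {\<X> u -` {v} | u v. u \<in> {1..t}}"
  unfolding filt_def by (rule sets_measure_of) auto

lemma sets_filt_subset: "sets (filt \<X> t) \<subseteq> sets (filt_inf \<X>)"
proof -
  have "sets (filt_inf \<X>) = sigma_sets UNIV (\<Union>t. sets (filt \<X> t))"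
    unfolding filt_inf_def by (rule sets_measure_of) auto
  then show ?thesis by (auto intro: sigma_sets.Basic)
qed

text \<open>A fibre of \<open>path t\<close> is a finite intersection of generators, hence
  measurable, and there are only finitely many fibres. A union of fibres is therefore measurable,
  and no generator separates two outcomes with the same path.\<close>

lemma sets_filt_iff:
  "A \<in> sets (filt \<X> t) \<longleftrightarrow> (\<forall>\<omega> \<omega>'. path t \<omega> = path t \<omega>' \<longrightarrow> \<omega> \<in> A \<longrightarrow> \<omega>' \<in> A)"
proof
  assume "A \<in> sets (filt \<X> t)"
  then have "A \<in> sigma_sets UNIV {\<X> u -` {v} | u v. u \<in> {1..t}}" by (simp add: sets_filt_sigma)
  \<comment> \<open>Stated as an equivalence so that the induction passes through
    complements.\<close>
  then have "\<forall>\<omega> \<omega>'. path t \<omega> = path t \<omega>' \<longrightarrow> (\<omega> \<in> A \<longleftrightarrow> \<omega>' \<in> A)"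
  proof induction
    case (Basic a)
    then show ?case unfolding path_eq_iff by auto
  next
    case Empty
    then show ?case by simp
  next
    case (Compl a)
    then show ?case by blast
  next
    case (Union a)
    then show ?case by blast
  qed
  then show "\<forall>\<omega> \<omega>'. path t \<omega> = path t \<omega>' \<longrightarrow> \<omega> \<in> A \<longrightarrow> \<omega>' \<in> A" by blast
next
  assume A: "\<forall>\<omega> \<omega>'. path t \<omega> = path t \<omega>' \<longrightarrow> \<omega> \<in> A \<longrightarrow> \<omega>' \<in> A"
  have atom: "path t -` {p} \<in> sets (filt \<X> t)" if "p \<in> path t ` A" for p
  proof -
    from that obtain \<omega>0 where p: "p = path t \<omega>0" by auto
    have "{\<omega> \<in> space (filt \<X> t). \<forall>v\<in>{1..t}. \<X> v \<omega> = \<X> v \<omega>0} \<in> sets (filt \<X> t)"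
    proof (rule sets.sets_Collect_finite_All)
      fix v assume "v \<in> {1..t}"
      then have "\<X> v -` {\<X> v \<omega>0} \<in> sets (filt \<X> t)"
        unfolding sets_filt_sigma by (intro sigma_sets.Basic) blast
      then show "{\<omega> \<in> space (filt \<X> t). \<X> v \<omega> = \<X> v \<omega>0} \<in> sets (filt \<X> t)"
        by (simp add: vimage_def)
    qed (auto intro: sets.top)
    then show ?thesis unfolding p by (simp add: vimage_def path_eq_iff)
  qed
  have "A = (\<Union>p\<in>path t ` A. path t -` {p})" 
  proof (intro equalityI subsetI)
    fix \<omega> assume "\<omega> \<in> (\<Union>p\<in>path t ` A. path t -` {p})"
    then obtain \<omega>0 where "\<omega>0 \<in> A" "path t \<omega> = path t \<omega>0" by auto
    with A show "\<omega> \<in> A" by metis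
  qed auto
  moreover have "finite (path t ` A)" by (rule finite_subset[OF _ finite_range_path]) auto
  ultimately show "A \<in> sets (filt \<X> t)" using atom by (metis sets.finite_UN)
qed

text \<open>Points are closed in a \<open>t1_space\<close>, so level sets are measurable and hence
  unions of path fibres. The generality serves both \<open>real\<close> and
  \<open>ereal\<close>.\<close>

lemma measurable_filt_iff:
  fixes f :: "'w \<Rightarrow> 'b::t1_space"
  shows "f \<in> borel_measurable (filt \<X> t) \<longleftrightarrow> (\<forall>\<omega> \<omega>'. path t \<omega> = path t \<omega>' \<longrightarrow> f \<omega> = f \<omega>')"
proof
  assume f: "f \<in> borel_measurable (filt \<X> t)"
  show "\<forall>\<omega> \<omega>'. path t \<omega> = path t \<omega>' \<longrightarrow> f \<omega> = f \<omega>'"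
  proof (intro allI impI)
    fix \<omega> \<omega>' assume p: "path t \<omega> = path t \<omega>'"
    have "f -` {f \<omega>} \<inter> space (filt \<X> t) \<in> sets (filt \<X> t)"
      by (rule measurable_sets[OF f]) auto
    then have "\<omega> \<in> f -` {f \<omega>} \<longrightarrow> \<omega>' \<in> f -` {f \<omega>}"
      using p unfolding space_filt Int_UNIV_right sets_filt_iff by blast
    then show "f \<omega> = f \<omega>'" by simp
  qed
next
  assume f: "\<forall>\<omega> \<omega>'. path t \<omega> = path t \<omega>' \<longrightarrow> f \<omega> = f \<omega>'"
  show "f \<in> borel_measurable (filt \<X> t)"
  proof (rule measurableI)
    fix A :: "'b set"
    show "f -` A \<inter> space (filt \<X> t) \<in> sets (filt \<X> t)"
      unfolding space_filt Int_UNIV_right sets_filt_iff vimage_eq using f by metis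
  qed simp
qed

lemma measurable_filtI:
  fixes f :: "'w \<Rightarrow> 'b::t1_space"
  shows "(\<And>\<omega> \<omega>'. path t \<omega> = path t \<omega>' \<Longrightarrow> f \<omega> = f \<omega>') \<Longrightarrow> f \<in> borel_measurable (filt \<X> t)"
  unfolding measurable_filt_iff by blast

lemma measurable_filtD:
  fixes f :: "'w \<Rightarrow> 'b::t1_space"
  shows "f \<in> borel_measurable (filt \<X> t) \<Longrightarrow> path t \<omega> = path t \<omega>' \<Longrightarrow> f \<omega> = f \<omega>'"
  unfolding measurable_filt_iff by blast

lemma measurable_filt_mono:
  fixes f :: "'w \<Rightarrow> 'b::t1_space"
  shows "f \<in> borel_measurable (filt \<X> s) \<Longrightarrow> s \<le> t \<Longrightarrow> f \<in> borel_measurable (filt \<X> t)"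
  unfolding measurable_filt_iff using path_eq_le by blast

lemma finite_range_filt:
  fixes f :: "'w \<Rightarrow> 'b::t1_space"
  assumes "f \<in> borel_measurable (filt \<X> t)"
  shows "finite (range f)"
proof -
  have "range f = (\<lambda>p. f (SOME \<omega>. path t \<omega> = p)) ` range (path t)"
  proof -
    have "f (SOME \<omega>'. path t \<omega>' = path t \<omega>) = f \<omega>" for \<omega>
      by (rule measurable_filtD[OF assms]) (rule someI, rule refl)
    then show ?thesis by (auto simp: image_image)
  qed
  then show ?thesis using finite_range_path by simp
qed

section \<open>Closure properties of \<open>H\<close> and pointwise rules for
  \<open>E t\<close>\<close>

lemma H_measurableD: "Y \<in> H \<Longrightarrow> Y \<in> borel_measurable (filt_inf \<X>)"
  using H_measurable by blast

lemma H_uminus: "Y \<in> H \<Longrightarrow> (\<lambda>\<omega>. - Y \<omega>) \<in> H"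
  using H_scale[of Y "-1"] by simp

lemma H_diff: "X \<in> H \<Longrightarrow> Y \<in> H \<Longrightarrow> (\<lambda>\<omega>. X \<omega> - Y \<omega>) \<in> H"
  using H_add[of X "\<lambda>\<omega>. - Y \<omega>"] H_uminus[of Y] by simp

lemma H_sum: "(\<And>i. i \<in> I \<Longrightarrow> F i \<in> H) \<Longrightarrow> (\<lambda>\<omega>. \<Sum>i\<in>I. F i \<omega>) \<in> H"
  by (induction I rule: infinite_finite_induct) (auto intro: H_const H_add)

lemma H_ind: "A \<in> sets (filt_inf \<X>) \<Longrightarrow> indicator A \<in> H"
  using H_indicator[OF H_const[of 1]] by simp

text \<open>\<open>H\<close> is not assumed closed under products. But \<open>l\<close> has only
  finitely many values, so the product is a finite linear combination of functions
  \<open>indicator A * Y\<close>.\<close>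

lemma H_mult_filt:
  assumes l: "l \<in> borel_measurable (filt \<X> t)" and Y: "Y \<in> H"
  shows "(\<lambda>\<omega>. l \<omega> * Y \<omega>) \<in> H"
proof -
  have "(\<lambda>\<omega>. l \<omega> * Y \<omega>) = (\<lambda>\<omega>. \<Sum>y\<in>range l. y * (indicator (l -` {y}) \<omega> * Y \<omega>))"
  proof
    fix \<omega>
    have "(\<Sum>y\<in>range l. y * (indicator (l -` {y}) \<omega> * Y \<omega>))
        = (\<Sum>y\<in>range l. if y = l \<omega> then l \<omega> * Y \<omega> else 0)"
      by (intro sum.cong) (auto simp: indicator_def)
    also have "\<dots> = l \<omega> * Y \<omega>" using finite_range_filt[OF l] by simp
    finally show "l \<omega> * Y \<omega> = (\<Sum>y\<in>range l. y * (indicator (l -` {y}) \<omega> * Y \<omega>))" by simp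
  qed
  moreover have "l -` {y} \<in> sets (filt_inf \<X>)" for y
    using measurable_sets[OF l, of "{y}"] sets_filt_subset[of t] by auto
  ultimately show ?thesis using Y by (auto intro!: H_sum H_scale H_indicator)
qed

lemma H_filt: "l \<in> borel_measurable (filt \<X> t) \<Longrightarrow> l \<in> H"
  using H_mult_filt[OF _ H_const[of 1]] by simp

lemma E_H: "Y \<in> H \<Longrightarrow> E t Y \<in> H"
  and E_filt: "Y \<in> H \<Longrightarrow> E t Y \<in> borel_measurable (filt \<X> t)"
  using E_range by auto

lemma E_filt_id: "Y \<in> borel_measurable (filt \<X> t) \<Longrightarrow> E t Y = Y"
  using E_id H_filt by auto

lemma E_const: "E t (\<lambda>_. c) = (\<lambda>_. c)"
  by (rule E_filt_id) simp

lemma E_scale_nonneg: "Y \<in> H \<Longrightarrow> 0 \<le> c \<Longrightarrow> E t (\<lambda>\<omega>. c * Y \<omega>) \<omega> = c * E t Y \<omega>"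
  using E_scale[of "\<lambda>_. c" t Y \<omega>] H_const H_scale by auto

lemma E_mult_filt:
  assumes "l \<in> borel_measurable (filt \<X> t)" "Y \<in> H"
  shows "E t (\<lambda>\<omega>. l \<omega> * Y \<omega>) \<omega> =
    max (l \<omega>) 0 * E t Y \<omega> + max (- l \<omega>) 0 * E t (\<lambda>\<omega>. - Y \<omega>) \<omega>"
  using assms H_filt[OF assms(1)] H_mult_filt by (intro E_scale) auto

text \<open>Subadditivity gives one inequality directly. The other comes from applying it to
  \<open>Y = - f + (f + Y)\<close>, because \<open>E t\<close> fixes both \<open>f\<close> and
  \<open>- f\<close>.\<close>

lemma E_translate:
  assumes f: "f \<in> borel_measurable (filt \<X> t)" and Y: "Y \<in> H"
  shows "E t (\<lambda>\<omega>. f \<omega> + Y \<omega>) \<omega> = f \<omega> + E t Y \<omega>"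
proof (rule antisym)
  have fH: "f \<in> H" using H_filt[OF f] .
  show "E t (\<lambda>\<omega>. f \<omega> + Y \<omega>) \<omega> \<le> f \<omega> + E t Y \<omega>"
    using E_subadd[OF fH Y, of t \<omega>] E_filt_id[OF f] by simp
  have "E t (\<lambda>\<omega>. - f \<omega> + (f \<omega> + Y \<omega>)) \<omega> \<le> E t (\<lambda>\<omega>. - f \<omega>) \<omega> + E t (\<lambda>\<omega>. f \<omega> + Y \<omega>) \<omega>"
    by (intro E_subadd H_uminus H_add fH Y)
  moreover have "E t (\<lambda>\<omega>. - f \<omega>) = (\<lambda>\<omega>. - f \<omega>)"
    using f by (intro E_filt_id) simp
  ultimately show "f \<omega> + E t Y \<omega> \<le> E t (\<lambda>\<omega>. f \<omega> + Y \<omega>) \<omega>" by simp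
qed

text \<open>Monotonicity and subadditivity applied to X \<le> Y + |X - Y|, and the same with X and Y
  exchanged.\<close>

lemma E_diff_le: "X \<in> H \<Longrightarrow> Y \<in> H \<Longrightarrow> \<bar>E t X \<omega> - E t Y \<omega>\<bar> \<le> E t (\<lambda>\<omega>. \<bar>X \<omega> - Y \<omega>\<bar>) \<omega>"
proof -
  have *: "E t X \<omega> \<le> E t Y \<omega> + E t (\<lambda>\<omega>. \<bar>X \<omega> - Y \<omega>\<bar>) \<omega>" if "X \<in> H" "Y \<in> H" for X Y
  proof -
    have "E t X \<omega> \<le> E t (\<lambda>\<omega>. Y \<omega> + \<bar>X \<omega> - Y \<omega>\<bar>) \<omega>"
      using that by (intro E_mono H_add H_abs H_diff) auto
    also have "\<dots> \<le> E t Y \<omega> + E t (\<lambda>\<omega>. \<bar>X \<omega> - Y \<omega>\<bar>) \<omega>"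
      using that by (intro E_subadd H_abs H_diff)
    finally show ?thesis .
  qed
  assume "X \<in> H" "Y \<in> H"
  then show ?thesis using *[of X Y] *[of Y X] unfolding abs_minus_commute[of "Y _" "X _"] by linarith
qed

section \<open>The expectation at time 0 and its norm\<close>

lemma E0_eq: "Y \<in> H \<Longrightarrow> E 0 Y \<omega> = expect E Y"
proof -
  assume "Y \<in> H"
  then have eq: "E 0 Y \<omega>1 = E 0 Y \<omega>2" for \<omega>1 \<omega>2
    \<comment> \<open>All outcomes share the empty \<open>path 0\<close>, so \<open>E 0 Y\<close> is
      constant and the description \<open>THE\<close> in \<open>expect\<close> is well
      defined.\<close>
    by (intro measurable_filtD[OF E_filt]) (auto simp: path_def)
  have c: "E 0 Y = (\<lambda>_. E 0 Y \<omega>)" by (rule ext) (rule eq)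
  have "(THE c. E 0 Y = (\<lambda>_. c)) = E 0 Y \<omega>"
  proof (rule the_equality)
    show "E 0 Y = (\<lambda>_. E 0 Y \<omega>)" by (rule c)
    show "c = E 0 Y \<omega>" if "E 0 Y = (\<lambda>_. c)" for c by (simp add: that)
  qed
  then show ?thesis by (simp add: expect_def)
qed

lemma expect_mono: "X \<in> H \<Longrightarrow> Y \<in> H \<Longrightarrow> (\<And>\<omega>. Y \<omega> \<le> X \<omega>) \<Longrightarrow> expect E Y \<le> expect E X"
  \<comment> \<open>\<open>E 0\<close> yields constant functions, so it can be evaluated at an
    arbitrary outcome such as \<open>undefined\<close>.\<close>
  using E_mono[of X Y 0 undefined] by (simp add: E0_eq)

lemma expect_add_le: "X \<in> H \<Longrightarrow> Y \<in> H \<Longrightarrow> expect E (\<lambda>\<omega>. X \<omega> + Y \<omega>) \<le> expect E X + expect E Y"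
  using E_subadd[of X Y 0 undefined] by (simp add: E0_eq H_add)

lemma expect_scale: "Y \<in> H \<Longrightarrow> 0 \<le> c \<Longrightarrow> expect E (\<lambda>\<omega>. c * Y \<omega>) = c * expect E Y"
  using E_scale_nonneg[of Y c 0 undefined] by (simp add: E0_eq H_scale)

lemma expect_const: "expect E (\<lambda>_. c) = c"
  using E_const[of 0 c] E0_eq[OF H_const[of c]] by simp

lemma expect_nonneg: "Y \<in> H \<Longrightarrow> (\<And>\<omega>. 0 \<le> Y \<omega>) \<Longrightarrow> 0 \<le> expect E Y"
  using expect_mono[OF _ H_const[of 0], of Y] by (simp add: expect_const)

lemma expect_E: "Y \<in> H \<Longrightarrow> expect E (E t Y) = expect E Y"
  using E_tower[of Y 0 t] by (metis E0_eq E_H le0)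

lemma norm1_nonneg: "X \<in> H \<Longrightarrow> 0 \<le> norm1 E X"
  unfolding norm1_def by (intro expect_nonneg H_abs) auto

lemma norm1_triangle: "X \<in> H \<Longrightarrow> Y \<in> H \<Longrightarrow> norm1 E (\<lambda>\<omega>. X \<omega> + Y \<omega>) \<le> norm1 E X + norm1 E Y"
  unfolding norm1_def
  by (intro order_trans[OF expect_mono expect_add_le] H_add H_abs) auto

lemma norm1_commute: "norm1 E (\<lambda>\<omega>. X \<omega> - Y \<omega>) = norm1 E (\<lambda>\<omega>. Y \<omega> - X \<omega>)"
  unfolding norm1_def by (simp add: abs_minus_commute)

lemma norm1_diff_triangle:
  "X \<in> H \<Longrightarrow> Y \<in> H \<Longrightarrow> Z \<in> H \<Longrightarrow>
    norm1 E (\<lambda>\<omega>. X \<omega> - Z \<omega>) \<le> norm1 E (\<lambda>\<omega>. X \<omega> - Y \<omega>) + norm1 E (\<lambda>\<omega>. Y \<omega> - Z \<omega>)"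
  using norm1_triangle[of "\<lambda>\<omega>. X \<omega> - Y \<omega>" "\<lambda>\<omega>. Y \<omega> - Z \<omega>"] H_diff by auto

text \<open>\<open>E_diff_le\<close> followed by the tower property at time 0. This
  non-expansiveness is what extends \<open>E t\<close> to the completion.\<close>

lemma norm1_E_diff:
  assumes "X \<in> H" "Y \<in> H"
  shows "norm1 E (\<lambda>\<omega>. E t X \<omega> - E t Y \<omega>) \<le> norm1 E (\<lambda>\<omega>. X \<omega> - Y \<omega>)"
proof -
  have H: "(\<lambda>\<omega>. \<bar>X \<omega> - Y \<omega>\<bar>) \<in> H" using assms by (intro H_abs H_diff)
  have "norm1 E (\<lambda>\<omega>. E t X \<omega> - E t Y \<omega>) \<le> expect E (E t (\<lambda>\<omega>. \<bar>X \<omega> - Y \<omega>\<bar>))"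
    unfolding norm1_def using assms H
    by (intro expect_mono E_diff_le E_H H_abs H_diff) auto
  also have "\<dots> = norm1 E (\<lambda>\<omega>. X \<omega> - Y \<omega>)" unfolding norm1_def by (rule expect_E[OF H])
  finally show ?thesis .
qed

text \<open>A substitute for dominated convergence, with |Y| as the dominating function. Every
  outcome leaves the sets \<open>A n\<close> for good from some index on, so the functions decrease
  to 0 pointwise and \<open>E_continuous\<close> applies.\<close>

lemma expect_decreasing_sets:
  assumes Y: "Y \<in> H" and A: "\<And>n. A n \<in> sets (filt_inf \<X>)"
    and dec: "decseq A" and int: "(\<Inter>n. A n) = {}"
  shows "(\<lambda>n. expect E (\<lambda>\<omega>. indicator (A n) \<omega> * \<bar>Y \<omega>\<bar>)) \<longlonglongrightarrow> 0"
proof -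
  have H: "(\<lambda>\<omega>. indicator (A n) \<omega> * \<bar>Y \<omega>\<bar>) \<in> H" for n
    by (intro H_indicator H_abs Y A)
  have "(\<lambda>n. E 0 (\<lambda>\<omega>. indicator (A n) \<omega> * \<bar>Y \<omega>\<bar>) \<omega>) \<longlonglongrightarrow> 0" for \<omega>
  proof (rule E_continuous[OF H])
    show "decseq (\<lambda>i. indicator (A i) \<omega> * \<bar>Y \<omega>\<bar>)" for \<omega>
      using dec unfolding decseq_def by (auto simp: indicator_def)
    show "(\<lambda>i. indicator (A i) \<omega> * \<bar>Y \<omega>\<bar>) \<longlonglongrightarrow> 0" for \<omega>
    proof (rule tendsto_eventually)
      obtain n where "\<omega> \<notin> A n" using int by auto
      then have "\<omega> \<notin> A m" if "m \<ge> n" for m using dec that unfolding decseq_def by blast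
      then have "indicator (A m) \<omega> * \<bar>Y \<omega>\<bar> = 0" if "m \<ge> n" for m using that by (simp add: indicator_def)
      then show "\<forall>\<^sub>F i in sequentially. indicator (A i) \<omega> * \<bar>Y \<omega>\<bar> = 0"
        unfolding eventually_sequentially by blast
    qed
  qed
  then show ?thesis using H by (simp add: E0_eq)
qed

section \<open>Quasi-sure statements and vanishing norms\<close>

lemma quasi_surelyI: "(\<And>\<omega>. P \<omega>) \<Longrightarrow> quasi_surely \<X> E P"
  unfolding quasi_surely_def by (rule bexI[of _ "{}"])
    (use expect_const[of 0] in \<open>auto simp: indicator_def[abs_def]\<close>)

lemma quasi_surely_mono:
  "quasi_surely \<X> E P \<Longrightarrow> (\<And>\<omega>. P \<omega> \<Longrightarrow> Q \<omega>) \<Longrightarrow> quasi_surely \<X> E Q"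
  unfolding quasi_surely_def by blast

lemma polar_Un:
  assumes "A \<in> sets (filt_inf \<X>)" "B \<in> sets (filt_inf \<X>)"
    and "expect E (indicator A) = 0" "expect E (indicator B) = 0"
  shows "expect E (indicator (A \<union> B)) = 0"
proof (rule antisym)
  have "expect E (indicator (A \<union> B)) \<le> expect E (\<lambda>\<omega>. indicator A \<omega> + indicator B \<omega>)"
    using assms(1,2) by (intro expect_mono H_add H_ind) (auto simp: indicator_def)
  also have "\<dots> \<le> expect E (indicator A) + expect E (indicator B)"
    using assms(1,2) by (intro expect_add_le H_ind)
  finally show "expect E (indicator (A \<union> B)) \<le> 0" using assms(3,4) by simp
qed (auto intro!: expect_nonneg H_ind assms)

lemma quasi_surely_conj:
  assumes "quasi_surely \<X> E P" "quasi_surely \<X> E Q"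
  shows "quasi_surely \<X> E (\<lambda>\<omega>. P \<omega> \<and> Q \<omega>)"
proof -
  obtain A B where "A \<in> sets (filt_inf \<X>)" "expect E (indicator A) = 0" "\<And>\<omega>. \<omega> \<notin> A \<Longrightarrow> P \<omega>"
    and "B \<in> sets (filt_inf \<X>)" "expect E (indicator B) = 0" "\<And>\<omega>. \<omega> \<notin> B \<Longrightarrow> Q \<omega>"
    using assms unfolding quasi_surely_def by blast
  then show ?thesis
    unfolding quasi_surely_def by (intro bexI[of _ "A \<union> B"]) (auto intro: polar_Un)
qed

lemma quasi_surely_Ball:
  fixes n :: nat
  shows "(\<And>i. i < n \<Longrightarrow> quasi_surely \<X> E (P i)) \<Longrightarrow> quasi_surely \<X> E (\<lambda>\<omega>. \<forall>i<n. P i \<omega>)"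
proof (induction n)
  case 0
  show ?case by (rule quasi_surelyI) simp
next
  case (Suc n)
  have "quasi_surely \<X> E (\<lambda>\<omega>. (\<forall>i<n. P i \<omega>) \<and> P n \<omega>)"
    by (intro quasi_surely_conj Suc) auto
  then show ?case by (rule quasi_surely_mono) (auto simp: less_Suc_eq)
qed

text \<open>\<open>X\<close> may be unbounded and arbitrarily close to 0. Each direction cuts off
  the troublesome values of |X|, large ones in the first and small nonzero ones in the second, and
  removes them with \<open>expect_decreasing_sets\<close>.\<close>

lemma quasi_surely_zero_iff:
  assumes X: "X \<in> H"
  shows "quasi_surely \<X> E (\<lambda>\<omega>. X \<omega> = 0) \<longleftrightarrow> norm1 E X = 0"
proof
  have [measurable]: "X \<in> borel_measurable (filt_inf \<X>)" using H_measurableD[OF X] .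
  assume "quasi_surely \<X> E (\<lambda>\<omega>. X \<omega> = 0)"
  then obtain A where A: "A \<in> sets (filt_inf \<X>)" "expect E (indicator A) = 0"
    "\<And>\<omega>. \<omega> \<notin> A \<Longrightarrow> X \<omega> = 0" unfolding quasi_surely_def by blast
  \<comment> \<open>\<open>X\<close> vanishes off \<open>A\<close>, and on \<open>A\<close> its
    modulus is at most \<open>k\<close> unless the outcome lies in \<open>B k\<close>. The bound
    \<open>k * indicator A\<close> has expectation 0 for every \<open>k\<close>.\<close>
  define B where "B k = {\<omega> \<in> space (filt_inf \<X>). real k < \<bar>X \<omega>\<bar>}" for k
  have B: "B k \<in> sets (filt_inf \<X>)" for k unfolding B_def by measurable
  have le: "norm1 E X \<le> expect E (\<lambda>\<omega>. indicator (B k) \<omega> * \<bar>X \<omega>\<bar>)" for k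
  proof -
    have "norm1 E X \<le> expect E (\<lambda>\<omega>. indicator (B k) \<omega> * \<bar>X \<omega>\<bar> + real k * indicator A \<omega>)"
      unfolding norm1_def using A(1,3) B X
      by (intro expect_mono H_add H_scale H_indicator H_abs H_ind) (auto simp: indicator_def B_def)
    also have "\<dots> \<le> expect E (\<lambda>\<omega>. indicator (B k) \<omega> * \<bar>X \<omega>\<bar>) + expect E (\<lambda>\<omega>. real k * indicator A \<omega>)"
      using A(1) B X by (intro expect_add_le H_scale H_indicator H_abs H_ind)
    finally show ?thesis using A(1,2) by (simp add: expect_scale H_ind)
  qed
  have "(\<lambda>k. expect E (\<lambda>\<omega>. indicator (B k) \<omega> * \<bar>X \<omega>\<bar>)) \<longlonglongrightarrow> 0"
  proof (rule expect_decreasing_sets[OF X B])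
    show "decseq B" unfolding decseq_def B_def by auto
    have "\<exists>k. \<omega> \<notin> B k" for \<omega>
      using reals_Archimedean2[of "\<bar>X \<omega>\<bar>"] unfolding B_def by (auto intro: less_imp_le simp: not_less)
    then show "(\<Inter>n. B n) = {}" by auto
  qed
  then have "norm1 E X \<le> 0" using le by (intro LIMSEQ_le_const) auto
  then show "norm1 E X = 0" using norm1_nonneg[OF X] by simp
next
  have [measurable]: "X \<in> borel_measurable (filt_inf \<X>)" using H_measurableD[OF X] .
  assume 0: "norm1 E X = 0"
  define A where "A = {\<omega> \<in> space (filt_inf \<X>). X \<omega> \<noteq> 0}"
  \<comment> \<open>Markov's inequality: on \<open>A\<close> but off \<open>B n\<close> the modulus
    of \<open>X\<close> is at least \<open>1 / Suc n\<close>, so the indicator of \<open>A\<close>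
    is at most \<open>Suc n * |X|\<close> there, which has expectation 0.\<close>
  define B where "B n = {\<omega> \<in> space (filt_inf \<X>). X \<omega> \<noteq> 0 \<and> \<bar>X \<omega>\<bar> < 1 / real (Suc n)}" for n
  have A: "A \<in> sets (filt_inf \<X>)" unfolding A_def by measurable
  have B: "B n \<in> sets (filt_inf \<X>)" for n unfolding B_def by measurable
  have le: "expect E (indicator A) \<le> expect E (\<lambda>\<omega>. indicator (B n) \<omega> * \<bar>1\<bar>)" for n
  proof -
    have "indicator A \<omega> \<le> indicator (B n) \<omega> * \<bar>1\<bar> + real (Suc n) * \<bar>X \<omega>\<bar>" for \<omega>
      by (auto simp: indicator_def A_def B_def field_simps)
    then have "expect E (indicator A) \<le> expect E (\<lambda>\<omega>. indicator (B n) \<omega> * \<bar>1\<bar> + real (Suc n) * \<bar>X \<omega>\<bar>)"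
      using A B X by (intro expect_mono H_add H_scale H_indicator H_abs H_ind H_const)
    also have "\<dots> \<le> expect E (\<lambda>\<omega>. indicator (B n) \<omega> * \<bar>1\<bar>) + expect E (\<lambda>\<omega>. real (Suc n) * \<bar>X \<omega>\<bar>)"
      using B X by (intro expect_add_le H_scale H_indicator H_abs H_const)
    also have "expect E (\<lambda>\<omega>. real (Suc n) * \<bar>X \<omega>\<bar>) = real (Suc n) * norm1 E X"
      unfolding norm1_def using X by (intro expect_scale H_abs) auto
    finally show ?thesis using 0 by simp
  qed
  have "(\<lambda>n. expect E (\<lambda>\<omega>. indicator (B n) \<omega> * \<bar>1\<bar>)) \<longlonglongrightarrow> 0"
  proof (rule expect_decreasing_sets[OF H_const B])
    show "decseq B" unfolding decseq_def B_def
      by (auto simp: frac_le intro: less_le_trans)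
    have "\<exists>n. \<omega> \<notin> B n" for \<omega>
    proof (cases "X \<omega> = 0")
      case False
      then obtain n where "1 / real (Suc n) < \<bar>X \<omega>\<bar>"
        using reals_Archimedean[of "\<bar>X \<omega>\<bar>"] by (auto simp: inverse_eq_divide)
      then have "\<omega> \<notin> B n" by (auto simp: B_def)
      then show ?thesis ..
    qed (auto simp: B_def)
    then show "(\<Inter>n. B n) = {}" by auto
  qed
  then have "expect E (indicator A) \<le> 0" using le by (intro LIMSEQ_le_const) auto
  moreover have "0 \<le> expect E (indicator A)" by (intro expect_nonneg H_ind A) auto
  ultimately show "quasi_surely \<X> E (\<lambda>\<omega>. X \<omega> = 0)"
    unfolding quasi_surely_def using A by (intro bexI[of _ A]) (auto simp: A_def)
qed

lemma quasi_surely_eq_iff: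
  assumes "X \<in> H" "Y \<in> H"
  shows "quasi_surely \<X> E (\<lambda>\<omega>. X \<omega> = Y \<omega>) \<longleftrightarrow> norm1 E (\<lambda>\<omega>. X \<omega> - Y \<omega>) = 0"
  using quasi_surely_zero_iff[OF H_diff[OF assms]] by simp

lemma quasi_surely_E:
  assumes "X \<in> H" "Y \<in> H" "quasi_surely \<X> E (\<lambda>\<omega>. X \<omega> = Y \<omega>)"
  shows "quasi_surely \<X> E (\<lambda>\<omega>. E t X \<omega> = E t Y \<omega>)"
  using assms norm1_E_diff[OF assms(1,2), of t] norm1_nonneg[OF H_diff[OF E_H[of X t] E_H[of Y t]]]
  by (simp add: quasi_surely_eq_iff E_H)

section \<open>The completion and its elements measurable at a fixed time\<close>

lemma equiv_L1_rel: "equiv (L1_Cauchy H E) (L1_rel H E)"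
proof (rule equivI)
  show "L1_rel H E \<subseteq> L1_Cauchy H E \<times> L1_Cauchy H E" unfolding L1_rel_def by auto
  show "refl_on (L1_Cauchy H E) (L1_rel H E)"
    unfolding refl_on_def L1_rel_def by (auto simp: norm1_def expect_const)
  show "sym (L1_rel H E)"
  proof (rule symI)
    fix S T assume "(S, T) \<in> L1_rel H E"
    then show "(T, S) \<in> L1_rel H E"
      unfolding L1_rel_def using norm1_commute[of "S _" "T _"] by simp
  qed
  show "trans (L1_rel H E)"
  proof (rule transI)
    fix S T U assume ST: "(S, T) \<in> L1_rel H E" and TU: "(T, U) \<in> L1_rel H E"
    then have H: "S n \<in> H" "T n \<in> H" "U n \<in> H" for n
      unfolding L1_rel_def L1_Cauchy_def by auto
    have "(\<lambda>n. norm1 E (\<lambda>\<omega>. S n \<omega> - U n \<omega>)) \<longlonglongrightarrow> 0"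
    proof (rule tendsto_sandwich[of "\<lambda>_. 0"])
      show "(\<lambda>n. norm1 E (\<lambda>\<omega>. S n \<omega> - T n \<omega>) + norm1 E (\<lambda>\<omega>. T n \<omega> - U n \<omega>)) \<longlonglongrightarrow> 0"
        using ST TU unfolding L1_rel_def by (auto intro: tendsto_add_zero)
    qed (use H in \<open>auto intro!: always_eventually norm1_nonneg norm1_diff_triangle H_diff\<close>)
    then show "(S, U) \<in> L1_rel H E" using ST TU unfolding L1_rel_def by auto
  qed
qed

lemma L1_Cauchy_const: "X \<in> H \<Longrightarrow> (\<lambda>_. X) \<in> L1_Cauchy H E"
  unfolding L1_Cauchy_def by (simp add: norm1_def expect_const)

lemma L1_of_eq_iff:
  assumes "X \<in> H" "Y \<in> H"
  shows "L1_of H E X = L1_of H E Y \<longleftrightarrow> quasi_surely \<X> E (\<lambda>\<omega>. X \<omega> = Y \<omega>)"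
  unfolding L1_of_def eq_equiv_class_iff[OF equiv_L1_rel L1_Cauchy_const[OF assms(1)] L1_Cauchy_const[OF assms(2)]]
  using assms by (simp add: L1_rel_def L1_Cauchy_const quasi_surely_eq_iff LIMSEQ_const_iff)

lemma L1_Cauchy_map:
  assumes f: "\<And>X. X \<in> H \<Longrightarrow> f X \<in> H"
    and nonexpansive: "\<And>X Y. X \<in> H \<Longrightarrow> Y \<in> H \<Longrightarrow>
      norm1 E (\<lambda>\<omega>. f X \<omega> - f Y \<omega>) \<le> norm1 E (\<lambda>\<omega>. X \<omega> - Y \<omega>)"
    and S: "S \<in> L1_Cauchy H E"
  shows "(\<lambda>n. f (S n)) \<in> L1_Cauchy H E"
  using S f nonexpansive unfolding L1_Cauchy_def by simp (meson le_less_trans)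

text \<open>A map that does not expand \<open>norm1\<close> respects \<open>L1_rel\<close>, so the
  union over all representatives collapses to the single class obtained from the constant sequence.
  Both \<open>E_L1\<close> and \<open>L1_uminus\<close> are of this form.\<close>

lemma UN_L1_of:
  assumes f: "\<And>X. X \<in> H \<Longrightarrow> f X \<in> H"
    and nonexpansive: "\<And>X Y. X \<in> H \<Longrightarrow> Y \<in> H \<Longrightarrow>
      norm1 E (\<lambda>\<omega>. f X \<omega> - f Y \<omega>) \<le> norm1 E (\<lambda>\<omega>. X \<omega> - Y \<omega>)"
    and X: "X \<in> H"
  shows "(\<Union>S\<in>L1_of H E X. L1_rel H E `` {\<lambda>n. f (S n)}) = L1_of H E (f X)"
proof -
  have "(\<lambda>S. L1_rel H E `` {\<lambda>n. f (S n)}) respects L1_rel H E"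
  proof (rule congruentI)
    fix S T assume ST: "(S, T) \<in> L1_rel H E"
    then have C: "S \<in> L1_Cauchy H E" "T \<in> L1_Cauchy H E" unfolding L1_rel_def by auto
    then have H: "S n \<in> H" "T n \<in> H" for n unfolding L1_Cauchy_def by auto
    have "(\<lambda>n. norm1 E (\<lambda>\<omega>. f (S n) \<omega> - f (T n) \<omega>)) \<longlonglongrightarrow> 0"
      by (rule tendsto_sandwich[of "\<lambda>_. 0" _ _ "\<lambda>n. norm1 E (\<lambda>\<omega>. S n \<omega> - T n \<omega>)"])
        (use H f nonexpansive ST in \<open>auto intro!: always_eventually norm1_nonneg H_diff simp: L1_rel_def\<close>)
    then have "((\<lambda>n. f (S n)), (\<lambda>n. f (T n))) \<in> L1_rel H E"
      using C L1_Cauchy_map[of f, OF f nonexpansive] unfolding L1_rel_def by auto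
    then show "L1_rel H E `` {\<lambda>n. f (S n)} = L1_rel H E `` {\<lambda>n. f (T n)}"
      by (rule equiv_class_eq[OF equiv_L1_rel])
  qed
  from UN_equiv_class[OF equiv_L1_rel this L1_Cauchy_const[OF X]] show ?thesis
    unfolding L1_of_def .
qed

lemma E_L1_of: "X \<in> H \<Longrightarrow> E_L1 H E t (L1_of H E X) = L1_of H E (E t X)"
  unfolding E_L1_def by (intro UN_L1_of[of "E t"] E_H norm1_E_diff)

lemma L1_uminus_of: "X \<in> H \<Longrightarrow> L1_uminus H E (L1_of H E X) = L1_of H E (\<lambda>\<omega>. - X \<omega>)"
  unfolding L1_uminus_def
  by (rule UN_L1_of[of "\<lambda>X \<omega>. - X \<omega>"])
    (auto intro: H_uminus simp: norm1_def abs_minus_commute)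

lemma L1_plus_of:
  assumes X: "X \<in> H" and Y: "Y \<in> H"
  shows "L1_plus H E (L1_of H E X) (L1_of H E Y) = L1_of H E (\<lambda>\<omega>. X \<omega> + Y \<omega>)"
proof -
  have le: "norm1 E (\<lambda>\<omega>. (S \<omega> + T \<omega>) - (S' \<omega> + T' \<omega>))
      \<le> norm1 E (\<lambda>\<omega>. S \<omega> - S' \<omega>) + norm1 E (\<lambda>\<omega>. T \<omega> - T' \<omega>)"
    if "S \<in> H" "S' \<in> H" "T \<in> H" "T' \<in> H" for S S' T T'
    using norm1_triangle[OF H_diff[OF that(1,2)] H_diff[OF that(3,4)]] by (simp add: algebra_simps)
  have C: "(\<lambda>n \<omega>. S n \<omega> + T n \<omega>) \<in> L1_Cauchy H E" if "S \<in> L1_Cauchy H E" "T \<in> L1_Cauchy H E" for S T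
  proof -
    have H: "S n \<in> H" "T n \<in> H" for n using that unfolding L1_Cauchy_def by auto
    have "\<exists>K. \<forall>m\<ge>K. \<forall>n\<ge>K. norm1 E (\<lambda>\<omega>. (S m \<omega> + T m \<omega>) - (S n \<omega> + T n \<omega>)) < e" if "e > 0" for e
    proof -
      have "e / 2 > 0" using that by simp
      then obtain K L
        where "\<forall>m\<ge>K. \<forall>n\<ge>K. norm1 E (\<lambda>\<omega>. S m \<omega> - S n \<omega>) < e / 2"
          and "\<forall>m\<ge>L. \<forall>n\<ge>L. norm1 E (\<lambda>\<omega>. T m \<omega> - T n \<omega>) < e / 2"
        using \<open>S \<in> L1_Cauchy H E\<close> \<open>T \<in> L1_Cauchy H E\<close> unfolding L1_Cauchy_def by blast
      then have "norm1 E (\<lambda>\<omega>. (S m \<omega> + T m \<omega>) - (S n \<omega> + T n \<omega>)) < e"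
        if "m \<ge> max K L" "n \<ge> max K L" for m n
        using le[OF H(1)[of m] H(1)[of n] H(2)[of m] H(2)[of n]] that by force
      then show ?thesis by blast
    qed
    then show ?thesis using H unfolding L1_Cauchy_def by (auto intro: H_add)
  qed
  have "(\<lambda>S T. L1_rel H E `` {\<lambda>n \<omega>. S n \<omega> + T n \<omega>}) respects2 L1_rel H E"
  proof (rule congruent2I')
    fix S S' T T' assume r: "(S, S') \<in> L1_rel H E" "(T, T') \<in> L1_rel H E"
    then have c: "S \<in> L1_Cauchy H E" "T \<in> L1_Cauchy H E" "S' \<in> L1_Cauchy H E" "T' \<in> L1_Cauchy H E"
      unfolding L1_rel_def by auto
    then have H: "S n \<in> H" "S' n \<in> H" "T n \<in> H" "T' n \<in> H" for n unfolding L1_Cauchy_def by auto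
    have "(\<lambda>n. norm1 E (\<lambda>\<omega>. (S n \<omega> + T n \<omega>) - (S' n \<omega> + T' n \<omega>))) \<longlonglongrightarrow> 0"
    proof (rule tendsto_sandwich[of "\<lambda>_. 0"])
      show "(\<lambda>n. norm1 E (\<lambda>\<omega>. S n \<omega> - S' n \<omega>) + norm1 E (\<lambda>\<omega>. T n \<omega> - T' n \<omega>)) \<longlonglongrightarrow> 0"
        using r unfolding L1_rel_def by (auto intro: tendsto_add_zero)
    qed (use H le in \<open>auto intro!: always_eventually norm1_nonneg H_diff H_add\<close>)
    then have "((\<lambda>n \<omega>. S n \<omega> + T n \<omega>), (\<lambda>n \<omega>. S' n \<omega> + T' n \<omega>)) \<in> L1_rel H E"
      using C c unfolding L1_rel_def by auto
    then show "L1_rel H E `` {\<lambda>n \<omega>. S n \<omega> + T n \<omega>} = L1_rel H E `` {\<lambda>n \<omega>. S' n \<omega> + T' n \<omega>}"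
      by (rule equiv_class_eq[OF equiv_L1_rel])
  qed
  from UN_equiv_class2[OF equiv_L1_rel equiv_L1_rel this L1_Cauchy_const[OF X] L1_Cauchy_const[OF Y]]
  show ?thesis unfolding L1_of_def L1_plus_def .
qed

text \<open>An Egorov argument in two stages. First the limit \<open>f\<close> of a representing
  sequence \<open>S\<close> is shown to be finite quasi-surely, so that it can be replaced by a real
  function \<open>g\<close>. Then quasi-sure convergence to \<open>g\<close> is upgraded to
  convergence in \<open>norm1\<close>, using that \<open>S\<close> is Cauchy.\<close>

lemma L1_measurableE:
  assumes "a \<in> L1_measurable \<X> H E t"
  obtains g where "g \<in> borel_measurable (filt \<X> t)" "a = L1_of H E g"
proof -
  from assms obtain f S where a: "a \<in> L1 H E" "S \<in> a"
    and f: "(f :: 'w \<Rightarrow> ereal) \<in> borel_measurable (filt \<X> t)"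
    and "quasi_surely \<X> E (\<lambda>\<omega>. (\<lambda>n. ereal (S n \<omega>)) \<longlonglongrightarrow> f \<omega>)"
    unfolding L1_measurable_def by auto
  then obtain P where P: "P \<in> sets (filt_inf \<X>)" "expect E (indicator P) = 0"
    and lim: "\<And>\<omega>. \<omega> \<notin> P \<Longrightarrow> (\<lambda>n. ereal (S n \<omega>)) \<longlonglongrightarrow> f \<omega>"
    unfolding quasi_surely_def by blast
  have C: "S \<in> L1_Cauchy H E" and aS: "a = L1_rel H E `` {S}"
    using a equiv_L1_rel unfolding L1_def
    by (auto elim!: quotientE dest: equiv_class_eq intro: equivE simp: L1_rel_def)
  have S: "S n \<in> H" for n using C unfolding L1_Cauchy_def by auto
  have [measurable]: "S n \<in> borel_measurable (filt_inf \<X>)" for n using H_measurableD[OF S] .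
  have [measurable]: "P \<in> sets (filt_inf \<X>)" by fact
  have Cauchy: "\<exists>K. \<forall>m\<ge>K. \<forall>n\<ge>K. norm1 E (\<lambda>\<omega>. S m \<omega> - S n \<omega>) < e" if "e > 0" for e
    using C that unfolding L1_Cauchy_def mem_Collect_eq by blast
  define Q where "Q = {\<omega>. \<bar>f \<omega>\<bar> = \<infinity>}"
  have Q: "Q \<in> sets (filt_inf \<X>)"
  proof -
    have "Q \<in> sets (filt \<X> t)" 
      unfolding Q_def sets_filt_iff mem_Collect_eq using measurable_filtD[OF f] by metis
    then show ?thesis using sets_filt_subset by auto
  qed
  note [measurable] = Q
  have QP: "Q - P \<in> sets (filt_inf \<X>)" using P(1) Q by auto
  \<comment> \<open>On \<open>Q - P\<close> the \<open>\<bar>S n\<bar>\<close> tend to infinity, while their norms stay bounded.\<close>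
  have "expect E (indicator (Q - P)) \<le> 0"
  proof (rule field_le_epsilon)
    fix e :: real assume "e > 0"
    obtain K where K: "\<forall>m\<ge>K. \<forall>n\<ge>K. norm1 E (\<lambda>\<omega>. S m \<omega> - S n \<omega>) < 1" using Cauchy[of 1] by auto
    \<comment> \<open>For n \<ge> K the norm of \<open>S n\<close> is at most
      \<open>norm1 E (S K) + 1\<close>; dividing that bound by \<open>c\<close> gives exactly
      \<open>e\<close>, the allowed error in Markov's inequality.\<close>
    define c where "c = (norm1 E (S K) + 1) / e"
    have c: "c > 0" using norm1_nonneg[OF S, of K] \<open>e > 0\<close> unfolding c_def by (simp add: field_simps add_nonneg_pos)
    \<comment> \<open>The outcomes of \<open>Q - P\<close> at which the sequence still falls below
      \<open>c\<close> at or after index \<open>n\<close>. Since |S n| tends to infinity on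
      \<open>Q - P\<close>, every outcome eventually leaves these sets.\<close>
    define B where "B n = {\<omega> \<in> space (filt_inf \<X>). \<omega> \<in> Q - P \<and> (\<exists>m\<ge>n. \<bar>S m \<omega>\<bar> < c)}" for n
    have B: "B n \<in> sets (filt_inf \<X>)" for n unfolding B_def by measurable
    have "expect E (indicator (Q - P)) \<le> expect E (\<lambda>\<omega>. indicator (B n) \<omega> * \<bar>1\<bar>) + e" if "n \<ge> K" for n
    proof -
      have "indicator (Q - P) \<omega> \<le> indicator (B n) \<omega> * \<bar>1\<bar> + (1 / c) * \<bar>S n \<omega>\<bar>" for \<omega>
        using c by (auto simp: indicator_def B_def field_simps not_less)
      then have "expect E (indicator (Q - P)) \<le> expect E (\<lambda>\<omega>. indicator (B n) \<omega> * \<bar>1\<bar> + (1 / c) * \<bar>S n \<omega>\<bar>)"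
        using QP B S by (intro expect_mono H_add H_scale H_indicator H_abs H_ind H_const)
      also have "\<dots> \<le> expect E (\<lambda>\<omega>. indicator (B n) \<omega> * \<bar>1\<bar>) + expect E (\<lambda>\<omega>. (1 / c) * \<bar>S n \<omega>\<bar>)"
        using B S by (intro expect_add_le H_scale H_indicator H_abs H_const)
      also have "expect E (\<lambda>\<omega>. (1 / c) * \<bar>S n \<omega>\<bar>) = (1 / c) * norm1 E (S n)"
        unfolding norm1_def using S c by (intro expect_scale H_abs) auto
      also have "norm1 E (S n) \<le> norm1 E (\<lambda>\<omega>. S n \<omega> - S K \<omega>) + norm1 E (S K)"
        using norm1_triangle[OF H_diff[OF S S] S, of n K K] by simp
      also have "\<dots> \<le> 1 + norm1 E (S K)" using K that by (simp add: less_imp_le)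
      also have "1 / c * (1 + norm1 E (S K)) = e"
        using norm1_nonneg[OF S, of K] \<open>e > 0\<close> unfolding c_def by (simp add: field_simps)
      finally show ?thesis using c by (simp add: divide_right_mono)
    qed
    moreover have "(\<lambda>n. expect E (\<lambda>\<omega>. indicator (B n) \<omega> * \<bar>1\<bar>) + e) \<longlonglongrightarrow> 0 + e"
    proof (intro tendsto_add tendsto_const expect_decreasing_sets[OF H_const B])
      show "decseq B" unfolding decseq_def B_def by (auto intro: order_trans)
      have "\<exists>n. \<omega> \<notin> B n" if "\<omega> \<in> Q - P" for \<omega>
      proof -
        have "(\<lambda>n. \<bar>ereal (S n \<omega>)\<bar>) \<longlonglongrightarrow> \<infinity>"
          using tendsto_abs_ereal[OF lim[of \<omega>]] that unfolding Q_def by auto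
        then have "\<forall>\<^sub>F n in sequentially. ereal c < \<bar>ereal (S n \<omega>)\<bar>"
          by (rule order_tendstoD) simp
        then show ?thesis unfolding B_def eventually_sequentially by force
      qed
      moreover have "B n \<subseteq> Q - P" for n by (auto simp: B_def)
      ultimately show "(\<Inter>n. B n) = {}" by blast
    qed
    ultimately show "expect E (indicator (Q - P)) \<le> 0 + e"
      by (intro LIMSEQ_le_const) auto
  qed
  moreover have "0 \<le> expect E (indicator (Q - P))" by (intro expect_nonneg H_ind QP) auto
  ultimately have polar: "expect E (indicator (P \<union> (Q - P))) = 0"
    using P QP by (intro polar_Un) auto
  define R where "R = P \<union> Q"
  have R [measurable]: "R \<in> sets (filt_inf \<X>)" and polarR: "expect E (indicator R) = 0"
    using P Q polar unfolding R_def by auto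
  \<comment> \<open>\<open>real_of_ereal\<close> sends infinite values to 0; this alters
    \<open>f\<close> only on \<open>Q\<close>, which lies in the polar set \<open>R\<close>.\<close>
  define g where "g \<omega> = real_of_ereal (f \<omega>)" for \<omega>
  have g: "g \<in> borel_measurable (filt \<X> t)" unfolding g_def using f by simp
  have gH: "g \<in> H" using H_filt[OF g] .
  have lim_g: "(\<lambda>n. S n \<omega>) \<longlonglongrightarrow> g \<omega>" if "\<omega> \<notin> R" for \<omega>
  proof -
    have "f \<omega> = ereal (g \<omega>)" using that unfolding g_def R_def Q_def by (simp add: ereal_real)
    then show ?thesis using lim[of \<omega>] that unfolding R_def by simp
  qed
  have "(\<lambda>n. norm1 E (\<lambda>\<omega>. S n \<omega> - g \<omega>)) \<longlonglongrightarrow> 0"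
  proof (rule LIMSEQ_I)
    fix e :: real assume "e > 0"
    \<comment> \<open>The final estimate consists of three terms of size at most \<delta>, so a
      quarter of \<open>e\<close> leaves room for strictness.\<close>
    define \<delta> where "\<delta> = e / 4"
    have \<delta>: "\<delta> > 0" using \<open>e > 0\<close> unfolding \<delta>_def by simp
    obtain K where K: "\<forall>m\<ge>K. \<forall>n\<ge>K. norm1 E (\<lambda>\<omega>. S m \<omega> - S n \<omega>) < \<delta>" using Cauchy[OF \<delta>] by auto
    have [measurable]: "g \<in> borel_measurable (filt_inf \<X>)" using H_measurableD[OF gH] .
    define T where "T n \<omega> = S n \<omega> - g \<omega>" for n \<omega>
    have T: "T n \<in> H" for n unfolding T_def using S gH by (intro H_diff)
    have [measurable]: "T n \<in> borel_measurable (filt_inf \<X>)" for n using H_measurableD[OF T] .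
    \<comment> \<open>Egorov's exceptional sets. Off \<open>B n\<close> and \<open>R\<close> the
      modulus of \<open>T n\<close> is at most \<delta>. On \<open>B n\<close> it is bounded by |T
      K| + |T n - T K|: here \<open>K\<close> is fixed, so |T K| can serve as dominating function,
      and the second summand is small by the Cauchy property.\<close>
    define B where "B n = {\<omega> \<in> space (filt_inf \<X>). \<omega> \<notin> R \<and> (\<exists>m\<ge>n. \<delta> < \<bar>T m \<omega>\<bar>)}" for n
    have B: "B n \<in> sets (filt_inf \<X>)" for n unfolding B_def by measurable
    have "(\<lambda>n. expect E (\<lambda>\<omega>. indicator (B n) \<omega> * \<bar>T K \<omega>\<bar>)) \<longlonglongrightarrow> 0"
    proof (rule expect_decreasing_sets[OF T B])
      show "decseq B" unfolding decseq_def B_def by (auto intro: order_trans)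
      have "\<exists>n. \<omega> \<notin> B n" if "\<omega> \<notin> R" for \<omega>
      proof -
        have "(\<lambda>n. T n \<omega>) \<longlonglongrightarrow> 0" unfolding T_def using lim_g[OF that] by (simp add: LIM_zero)
        from LIMSEQ_D[OF this \<delta>] show ?thesis unfolding B_def by fastforce
      qed
      moreover have "B n \<subseteq> - R" for n by (auto simp: B_def)
      ultimately show "(\<Inter>n. B n) = {}" by blast
    qed
    from LIMSEQ_D[OF this \<delta>] obtain L
      where L: "\<And>n. n \<ge> L \<Longrightarrow> expect E (\<lambda>\<omega>. indicator (B n) \<omega> * \<bar>T K \<omega>\<bar>) < \<delta>"
      by (auto simp: abs_less_iff)
    have "norm1 E (T n) < e" if n: "n \<ge> max K L" for n
    proof -
      have 1: "(\<lambda>\<omega>. \<bar>T n \<omega> - T K \<omega>\<bar>) \<in> H" "(\<lambda>\<omega>. indicator (B n) \<omega> * \<bar>T K \<omega>\<bar>) \<in> H"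
        "(\<lambda>\<omega>. indicator R \<omega> * \<bar>T n \<omega>\<bar>) \<in> H" "(\<lambda>_. \<delta>) \<in> H"
        using T B R by (auto intro!: H_abs H_diff H_indicator H_const)
      have "norm1 E (T n) \<le> expect E (\<lambda>\<omega>. (\<delta> + indicator (B n) \<omega> * \<bar>T K \<omega>\<bar>) +
          (\<bar>T n \<omega> - T K \<omega>\<bar> + indicator R \<omega> * \<bar>T n \<omega>\<bar>))"
        unfolding norm1_def
      proof (intro expect_mono H_add 1 H_abs T)
        show "\<bar>T n \<omega>\<bar> \<le> (\<delta> + indicator (B n) \<omega> * \<bar>T K \<omega>\<bar>) +
          (\<bar>T n \<omega> - T K \<omega>\<bar> + indicator R \<omega> * \<bar>T n \<omega>\<bar>)" for \<omega>
          using \<delta> by (cases "\<omega> \<in> R"; cases "\<delta> < \<bar>T n \<omega>\<bar>") (auto simp: indicator_def B_def)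
      qed
      also have "\<dots> \<le> (expect E (\<lambda>\<omega>. \<delta>) + expect E (\<lambda>\<omega>. indicator (B n) \<omega> * \<bar>T K \<omega>\<bar>)) +
          (expect E (\<lambda>\<omega>. \<bar>T n \<omega> - T K \<omega>\<bar>) + expect E (\<lambda>\<omega>. indicator R \<omega> * \<bar>T n \<omega>\<bar>))"
        by (intro order_trans[OF expect_add_le] add_mono expect_add_le H_add 1)
      also have "expect E (\<lambda>\<omega>. \<delta>) = \<delta>" by (rule expect_const)
      also have "expect E (\<lambda>\<omega>. indicator R \<omega> * \<bar>T n \<omega>\<bar>) = 0"
      proof -
        \<comment> \<open>\<open>T n\<close> may be unbounded on the polar set \<open>R\<close>, so
          the vanishing of this term rests on \<open>quasi_surely_zero_iff\<close>.\<close>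
        have "quasi_surely \<X> E (\<lambda>\<omega>. indicator R \<omega> * T n \<omega> = 0)"
          unfolding quasi_surely_def using R polarR by (intro bexI[of _ R]) auto
        then have "norm1 E (\<lambda>\<omega>. indicator R \<omega> * T n \<omega>) = 0"
          using quasi_surely_zero_iff[OF H_indicator[OF T R]] by simp
        then show ?thesis by (simp add: norm1_def abs_mult)
      qed
      also have "expect E (\<lambda>\<omega>. \<bar>T n \<omega> - T K \<omega>\<bar>) = norm1 E (\<lambda>\<omega>. S n \<omega> - S K \<omega>)"
        unfolding norm1_def T_def by simp
      finally have "norm1 E (T n) \<le> \<delta> + expect E (\<lambda>\<omega>. indicator (B n) \<omega> * \<bar>T K \<omega>\<bar>)
        + norm1 E (\<lambda>\<omega>. S n \<omega> - S K \<omega>)" by simp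
      moreover have "norm1 E (\<lambda>\<omega>. S n \<omega> - S K \<omega>) < \<delta>" using K n by simp
      ultimately show ?thesis using L[of n] n \<delta> unfolding \<delta>_def by simp
    qed
    then show "\<exists>no. \<forall>n\<ge>no. norm (norm1 E (\<lambda>\<omega>. S n \<omega> - g \<omega>) - 0) < e"
      using norm1_nonneg[OF T] unfolding T_def by (intro exI[of _ "max K L"]) simp
  qed
  then have "(S, \<lambda>_. g) \<in> L1_rel H E" unfolding L1_rel_def using C L1_Cauchy_const[OF gH] by simp
  then have "a = L1_of H E g" unfolding aS L1_of_def by (rule equiv_class_eq[OF equiv_L1_rel])
  with g show thesis by (rule that)
qed

section \<open>Conditional expectations of symmetric martingale differences\<close>

lemma symmetric_martingale_increment:
  assumes W: "\<And>u. W u \<in> borel_measurable (filt \<X> (Suc u))"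
    and sym: "symmetric_SL_martingale \<X> H E (\<lambda>t. L1_of H E (\<lambda>\<omega>. \<Sum>u<t. W u \<omega>))"
  shows "quasi_surely \<X> E (\<lambda>\<omega>. E u (W u) \<omega> = 0 \<and> E u (\<lambda>\<omega>. - W u \<omega>) \<omega> = 0)"
proof -
  define S where "S = (\<lambda>t \<omega>. \<Sum>u<t. W u \<omega>)"
  have sym': "symmetric_SL_martingale \<X> H E (\<lambda>t. L1_of H E (S t))"
    using sym unfolding S_def .
  have "W v \<in> borel_measurable (filt \<X> t)" if "v < t" for v t
    using measurable_filt_mono[OF W] that by simp
  then have S: "S t \<in> borel_measurable (filt \<X> t)" for t
    unfolding S_def by (intro borel_measurable_sum) auto
  have SH: "S t \<in> H" "(\<lambda>\<omega>. - S t \<omega>) \<in> H" for t using H_filt[OF S] H_uminus by auto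
  have WH: "W u \<in> H" "(\<lambda>\<omega>. - W u \<omega>) \<in> H" using H_filt[OF W] H_uminus by auto
  \<comment> \<open>The sum up to time \<open>u\<close> is known at time \<open>u\<close>, so
    \<open>E_translate\<close> isolates the last difference; the same is done below for the negated
    sum.\<close>
  have plus: "E u (S (Suc u)) = (\<lambda>\<omega>. S u \<omega> + E u (W u) \<omega>)"
  proof
    fix \<omega>
    have "S (Suc u) = (\<lambda>\<omega>. S u \<omega> + W u \<omega>)" by (simp add: S_def fun_eq_iff)
    then show "E u (S (Suc u)) \<omega> = S u \<omega> + E u (W u) \<omega>"
      using E_translate[OF S WH(1)] by simp
  qed
  have minus: "E u (\<lambda>\<omega>. - S (Suc u) \<omega>) = (\<lambda>\<omega>. - S u \<omega> + E u (\<lambda>\<omega>. - W u \<omega>) \<omega>)"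
  proof
    fix \<omega>
    have "(\<lambda>\<omega>. - S u \<omega>) \<in> borel_measurable (filt \<X> u)" using S by simp
    from E_translate[OF this WH(2)] show
      "E u (\<lambda>\<omega>. - S (Suc u) \<omega>) \<omega> = - S u \<omega> + E u (\<lambda>\<omega>. - W u \<omega>) \<omega>"
      by (simp add: S_def)
  qed
  have "L1_of H E (S u) = E_L1 H E u (L1_of H E (S (Suc u)))"
    using sym' unfolding symmetric_SL_martingale_def SL_martingale_def by (meson le_SucI order_refl)
  then have 1: "quasi_surely \<X> E (\<lambda>\<omega>. S u \<omega> = S u \<omega> + E u (W u) \<omega>)"
    using SH WH by (simp add: E_L1_of L1_of_eq_iff E_H H_add plus)
  \<comment> \<open>The martingale property makes \<open>E u (W u)\<close> vanish; symmetry between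
    times \<open>u\<close> and \<open>Suc u\<close> then carries this over to
    \<open>- W u\<close>.\<close>
  have "E_L1 H E u (L1_of H E (S (Suc u)))
      = L1_uminus H E (E_L1 H E u (L1_uminus H E (L1_of H E (S (Suc u)))))"
    using sym' unfolding symmetric_SL_martingale_def by blast
  then have 2: "quasi_surely \<X> E (\<lambda>\<omega>. E u (S (Suc u)) \<omega> = - E u (\<lambda>\<omega>. - S (Suc u) \<omega>) \<omega>)"
    using SH by (simp add: E_L1_of L1_uminus_of L1_of_eq_iff E_H H_uminus)
  show ?thesis
    by (rule quasi_surely_mono[OF quasi_surely_conj[OF 1 2]]) (simp add: plus minus)
qed

lemma E_sum_le:
  fixes n :: nat
  assumes "\<And>i. i < n \<Longrightarrow> F i \<in> H"
  shows "E t (\<lambda>\<omega>. \<Sum>i<n. F i \<omega>) \<omega> \<le> (\<Sum>i<n. E t (F i) \<omega>)"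
  using assms
proof (induction n)
  case 0
  show ?case by (simp add: E_const)
next
  case (Suc n)
  have "E t (\<lambda>\<omega>. (\<Sum>i<n. F i \<omega>) + F n \<omega>) \<omega> \<le> E t (\<lambda>\<omega>. \<Sum>i<n. F i \<omega>) \<omega> + E t (F n) \<omega>"
    using Suc.prems by (intro E_subadd H_sum) auto
  also have "E t (\<lambda>\<omega>. \<Sum>i<n. F i \<omega>) \<omega> \<le> (\<Sum>i<n. E t (F i) \<omega>)"
    using Suc by simp
  finally show ?case by simp
qed

text \<open>Positive homogeneity splits each coefficient into positive and negative part,
  multiplying \<open>E t (W i)\<close> and \<open>E t (- W i)\<close>, both 0. Hence the combination
  and its negative have conditional expectation at most 0, and subadditivity gives the two
  inequalities.\<close>

lemma E_add_symmetric:
  fixes n :: nat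
  assumes l: "\<And>i. i < n \<Longrightarrow> l i \<in> borel_measurable (filt \<X> t)"
    and W: "\<And>i. i < n \<Longrightarrow> W i \<in> H"
    and Y: "Y \<in> H"
    and sym: "\<And>i. i < n \<Longrightarrow> quasi_surely \<X> E (\<lambda>\<omega>. E t (W i) \<omega> = 0 \<and> E t (\<lambda>\<omega>. - W i \<omega>) \<omega> = 0)"
  shows "quasi_surely \<X> E (\<lambda>\<omega>. E t (\<lambda>\<omega>. (\<Sum>i<n. l i \<omega> * W i \<omega>) + Y \<omega>) \<omega> = E t Y \<omega>)"
proof (rule quasi_surely_mono[OF quasi_surely_Ball[of n, OF sym]])
  fix \<omega> assume good: "\<forall>i<n. E t (W i) \<omega> = 0 \<and> E t (\<lambda>\<omega>. - W i \<omega>) \<omega> = 0"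
  \<comment> \<open>The coefficients are generalised because the bound is applied both to
    \<open>l\<close> and to its negative.\<close>
  have nonpos: "E t (\<lambda>\<omega>. \<Sum>i<n. l i \<omega> * W i \<omega>) \<omega> \<le> 0"
    if "\<And>i. i < n \<Longrightarrow> l i \<in> borel_measurable (filt \<X> t)" for l
  proof -
    have "E t (\<lambda>\<omega>. \<Sum>i<n. l i \<omega> * W i \<omega>) \<omega> \<le> (\<Sum>i<n. E t (\<lambda>\<omega>. l i \<omega> * W i \<omega>) \<omega>)"
      using that W by (intro E_sum_le H_mult_filt)
    also have "\<dots> = 0" using good that W by (intro sum.neutral) (auto simp: E_mult_filt)
    finally show ?thesis .
  qed
  define V where "V \<omega> = (\<Sum>i<n. l i \<omega> * W i \<omega>)" for \<omega>
  have V: "V \<in> H" unfolding V_def using l W by (intro H_sum H_mult_filt) auto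
  have "E t V \<omega> \<le> 0" using nonpos[OF l] unfolding V_def by simp
  then have le: "E t (\<lambda>\<omega>. V \<omega> + Y \<omega>) \<omega> \<le> E t Y \<omega>"
    using E_subadd[OF V Y, of t \<omega>] by simp
  have "E t (\<lambda>\<omega>. - V \<omega>) \<omega> \<le> 0"
    using nonpos[of "\<lambda>i \<omega>. - l i \<omega>"] l unfolding V_def by (simp add: sum_negf)
  then have "E t Y \<omega> \<le> E t (\<lambda>\<omega>. V \<omega> + Y \<omega>) \<omega>"
    using E_subadd[OF H_add[OF V Y] H_uminus[OF V], of t \<omega>] by simp
  with le show "E t (\<lambda>\<omega>. (\<Sum>i<n. l i \<omega> * W i \<omega>) + Y \<omega>) \<omega> = E t Y \<omega>"
    unfolding V_def by simp
qed

end

section \<open>The adapted blocks and the single summands of a representation\<close>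

locale SL_basis = SL_expectation N \<X> H E
  for N :: nat and \<X> :: "nat \<Rightarrow> 'w \<Rightarrow> real vec" and H :: "('w \<Rightarrow> real) set"
    and E :: "nat \<Rightarrow> ('w \<Rightarrow> real) \<Rightarrow> 'w \<Rightarrow> real" +
  fixes M :: nat and \<phi>s \<phi>' :: "nat \<Rightarrow> 'w \<Rightarrow> real mat"
  assumes M: "M < N"
    and \<phi>s: "\<phi>s u \<omega> \<in> carrier_mat M N"
    and \<phi>': "\<phi>' u \<omega> \<in> carrier_mat (N - M - 1) N"
    and adapted: "adapted_mat \<X> N N (\<lambda>u \<omega>. mat_of_row (vec N (\<lambda>_. 1)) @\<^sub>r \<phi>s u \<omega> @\<^sub>r \<phi>' u \<omega>)"
    and invertible: "invertible_mat (mat_of_row (vec N (\<lambda>_. 1)) @\<^sub>r \<phi>s u \<omega> @\<^sub>r \<phi>' u \<omega>)"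
    and symmetric: "i < M \<Longrightarrow> symmetric_SL_martingale \<X> H E
          (\<lambda>t. L1_of H E (\<lambda>\<omega>. \<Sum>u<t. increment N \<X> \<phi>s u \<omega> $ i))"
begin

lemma \<phi>_cong:
  assumes "path u \<omega> = path u \<omega>'"
  shows "\<phi>s u \<omega> = \<phi>s u \<omega>'" "\<phi>' u \<omega> = \<phi>' u \<omega>'"
proof -
  let ?\<Phi> = "\<lambda>\<omega>. mat_of_row (vec N (\<lambda>_. 1)) @\<^sub>r \<phi>s u \<omega> @\<^sub>r \<phi>' u \<omega>"
  have eq: "?\<Phi> \<omega> $$ (i, j) = ?\<Phi> \<omega>' $$ (i, j)" if "i < N" "j < N" for i j
    using adapted that measurable_filtD[OF _ assms, of "\<lambda>\<omega>. ?\<Phi> \<omega> $$ (i, j)"]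
    unfolding adapted_mat_def by blast
  \<comment> \<open>Row 0 of the full matrix is the row of ones, so the two blocks start at rows 1
    and \<open>M + 1\<close>.\<close>
  have s: "\<phi>s u \<omega> $$ (i, j) = ?\<Phi> \<omega> $$ (Suc i, j)" if "i < M" "j < N" for i j \<omega>
    using that \<phi>s[of u \<omega>] \<phi>'[of u \<omega>] M by (simp add: append_rows_def)
  have p: "\<phi>' u \<omega> $$ (i, j) = ?\<Phi> \<omega> $$ (Suc (M + i), j)" if "i < N - M - 1" "j < N" for i j \<omega>
    using that \<phi>s[of u \<omega>] \<phi>'[of u \<omega>] M by (simp add: append_rows_def)
  show "\<phi>s u \<omega> = \<phi>s u \<omega>'"
  proof (rule eq_matI)
    fix i j assume "i < dim_row (\<phi>s u \<omega>')" "j < dim_col (\<phi>s u \<omega>')"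
    then have "i < M" "j < N" using \<phi>s[of u \<omega>'] by auto
    then show "\<phi>s u \<omega> $$ (i, j) = \<phi>s u \<omega>' $$ (i, j)"
      using s eq[of "Suc i" j] M by simp
  qed (use \<phi>s[of u \<omega>] \<phi>s[of u \<omega>'] in auto)
  show "\<phi>' u \<omega> = \<phi>' u \<omega>'"
  proof (rule eq_matI)
    fix i j assume "i < dim_row (\<phi>' u \<omega>')" "j < dim_col (\<phi>' u \<omega>')"
    then have "i < N - M - 1" "j < N" using \<phi>'[of u \<omega>'] by auto
    then show "\<phi>' u \<omega> $$ (i, j) = \<phi>' u \<omega>' $$ (i, j)"
      using p eq[of "Suc (M + i)" j] by simp
  qed (use \<phi>'[of u \<omega>] \<phi>'[of u \<omega>'] in auto)
qed

lemma increment_cong: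
  assumes "path (Suc u) \<omega> = path (Suc u) \<omega>'"
  shows "increment N \<X> \<phi>s u \<omega> = increment N \<X> \<phi>s u \<omega>'"
    "increment N \<X> \<phi>' u \<omega> = increment N \<X> \<phi>' u \<omega>'"
proof -
  have "cumul N \<X> t \<omega> = cumul N \<X> t \<omega>'" if "t \<le> Suc u" for t
    using path_eq_le[OF assms that] unfolding cumul_def path_eq_iff by (intro eq_vecI) auto
  then show "increment N \<X> \<phi>s u \<omega> = increment N \<X> \<phi>s u \<omega>'"
    "increment N \<X> \<phi>' u \<omega> = increment N \<X> \<phi>' u \<omega>'"
    using \<phi>_cong[OF path_eq_le[OF assms, of u]] unfolding increment_def by simp_all
qed

lemma adapted_vec_cong:
  assumes "adapted_vec \<X> n Z" "path u \<omega> = path u \<omega>'"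
  shows "Z u \<omega> = Z u \<omega>'"
proof (rule eq_vecI)
  have c: "Z u \<omega> \<in> carrier_vec n" "Z u \<omega>' \<in> carrier_vec n" using assms(1) unfolding adapted_vec_def by auto
  then show "dim_vec (Z u \<omega>) = dim_vec (Z u \<omega>')" by simp
  fix i assume "i < dim_vec (Z u \<omega>')"
  then have "(\<lambda>\<omega>. Z u \<omega> $ i) \<in> borel_measurable (filt \<X> u)" using assms(1) c unfolding adapted_vec_def by auto
  then show "Z u \<omega> $ i = Z u \<omega>' $ i" using assms(2) by (rule measurable_filtD)
qed

text \<open>Merging the three sums of \<open>represents\<close> into one makes the representation a
  telescoping statement about single time steps.\<close>

definition summand :: "(nat \<Rightarrow> 'w \<Rightarrow> real vec) \<Rightarrow> (nat \<Rightarrow> 'w \<Rightarrow> real vec) \<Rightarrow> nat \<Rightarrow> 'w \<Rightarrow> real" where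
  "summand Zs Z' u \<omega> = Zs u \<omega> \<bullet> increment N \<X> \<phi>s u \<omega> + Z' u \<omega> \<bullet> increment N \<X> \<phi>' u \<omega>
     - driver N \<X> E \<phi>' u (Z' u) \<omega>"

lemma driver_arg_measurable:
  assumes "adapted_vec \<X> n Z'"
  shows "(\<lambda>\<omega>. Z' u \<omega> \<bullet> increment N \<X> \<phi>' u \<omega>) \<in> borel_measurable (filt \<X> (Suc u))"
proof (rule measurable_filtI)
  fix \<omega> \<omega>' assume p: "path (Suc u) \<omega> = path (Suc u) \<omega>'"
  show "Z' u \<omega> \<bullet> increment N \<X> \<phi>' u \<omega> = Z' u \<omega>' \<bullet> increment N \<X> \<phi>' u \<omega>'"
    using adapted_vec_cong[OF assms path_eq_le[OF p, of u]] increment_cong[OF p] by simp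
qed

lemma driver_measurable:
  assumes "adapted_vec \<X> n Z'"
  shows "driver N \<X> E \<phi>' u (Z' u) \<in> borel_measurable (filt \<X> u)"
  unfolding driver_def by (rule E_filt[OF H_filt[OF driver_arg_measurable[OF assms]]])

lemma summand_measurable:
  assumes "adapted_vec \<X> m Zs" "adapted_vec \<X> n Z'"
  shows "summand Zs Z' u \<in> borel_measurable (filt \<X> (Suc u))"
proof (rule measurable_filtI)
  fix \<omega> \<omega>' assume p: "path (Suc u) \<omega> = path (Suc u) \<omega>'"
  have q: "path u \<omega> = path u \<omega>'" using path_eq_le[OF p] by simp
  show "summand Zs Z' u \<omega> = summand Zs Z' u \<omega>'"
    using adapted_vec_cong[OF assms(1) q] adapted_vec_cong[OF assms(2) q]
      increment_cong[OF p] measurable_filtD[OF driver_measurable[OF assms(2)] q]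
    unfolding summand_def by simp
qed

lemma sum_summand_H:
  assumes "adapted_vec \<X> m Zs" "adapted_vec \<X> n Z'"
  shows "(\<lambda>\<omega>. \<Sum>u<t. summand Zs Z' u \<omega>) \<in> H"
  using H_filt[OF summand_measurable[OF assms]] by (intro H_sum)

text \<open>All classes involved come from members of \<open>H\<close>, where \<open>L1_plus\<close>
  acts pointwise and equality of classes means quasi-sure equality.\<close>

lemma represents_iff:
  assumes g: "\<And>t. g t \<in> H" "\<And>t. X t = L1_of H E (g t)"
  shows "represents N M \<X> H E \<phi>s \<phi>' X Zs Z' \<longleftrightarrow>
    adapted_vec \<X> M Zs \<and> adapted_vec \<X> (N - M - 1) Z' \<and>
    (\<forall>t. quasi_surely \<X> E (\<lambda>\<omega>. g t \<omega> = g 0 \<omega> + (\<Sum>u<t. summand Zs Z' u \<omega>)))"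
proof -
  have "(\<lambda>\<omega>. (\<Sum>u<t. Zs u \<omega> \<bullet> increment N \<X> \<phi>s u \<omega>) + (\<Sum>u<t. Z' u \<omega> \<bullet> increment N \<X> \<phi>' u \<omega>)
        - (\<Sum>u<t. driver N \<X> E \<phi>' u (Z' u) \<omega>)) = (\<lambda>\<omega>. \<Sum>u<t. summand Zs Z' u \<omega>)" for t
    by (simp add: summand_def sum.distrib sum_subtractf)
  moreover have "L1_of H E (g t) = L1_plus H E (L1_of H E (g 0)) (L1_of H E (\<lambda>\<omega>. \<Sum>u<t. summand Zs Z' u \<omega>)) \<longleftrightarrow>
      quasi_surely \<X> E (\<lambda>\<omega>. g t \<omega> = g 0 \<omega> + (\<Sum>u<t. summand Zs Z' u \<omega>))"
    if "adapted_vec \<X> M Zs" "adapted_vec \<X> (N - M - 1) Z'" for t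
    using g(1) sum_summand_H[OF that] by (simp add: L1_plus_of L1_of_eq_iff H_add)
  ultimately show ?thesis unfolding represents_def g(2) by auto
qed

lemma integrand_eq:
  obtains i where "i < N" "\<X> (Suc u) \<omega> = unit_vec N i"
    "\<And>zs z'. zs \<bullet> increment N \<X> \<phi>s u \<omega> + z' \<bullet> increment N \<X> \<phi>' u \<omega>
      = integrand N (\<phi>s u \<omega>) (\<phi>' u \<omega>) zs z' i"
  using state[of "Suc u" \<omega>] integrand_cong_unit_vec[of \<X> u \<omega> N] by auto

section \<open>Solving and comparing single time steps\<close>

lemma one_step_exists:
  assumes g: "g \<in> borel_measurable (filt \<X> (Suc u))"
  shows "\<exists>zs z'. (\<forall>\<omega>. zs \<omega> \<in> carrier_vec M \<and> z' \<omega> \<in> carrier_vec (N - M - 1)) \<and>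
    (\<forall>\<omega> \<omega>'. path u \<omega> = path u \<omega>' \<longrightarrow> zs \<omega> = zs \<omega>' \<and> z' \<omega> = z' \<omega>') \<and>
    quasi_surely \<X> E (\<lambda>\<omega>. g \<omega> - E u g \<omega> = zs \<omega> \<bullet> increment N \<X> \<phi>s u \<omega>
      + z' \<omega> \<bullet> increment N \<X> \<phi>' u \<omega> - driver N \<X> E \<phi>' u z' \<omega>)"
proof -
  \<comment> \<open>Choosing the coefficients at one representative of each path makes them adapted.\<close>
  define r where "r \<omega> = (SOME \<omega>'. path u \<omega>' = path u \<omega>)" for \<omega>
  have r: "path u (r \<omega>) = path u \<omega>" for \<omega> unfolding r_def by (rule someI) (rule refl)
  have r_cong: "r \<omega> = r \<omega>'" if "path u \<omega> = path u \<omega>'" for \<omega> \<omega>' unfolding r_def that ..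
  \<comment> \<open>The value of \<open>g\<close> after the past of \<omega> when the next state is
    \<open>i\<close>. If that state never follows this past, \<open>SOME\<close> is unconstrained
    and the value is arbitrary.\<close>
  define c where "c \<omega> i = g (SOME \<omega>'. path u \<omega>' = path u \<omega> \<and> \<X> (Suc u) \<omega>' = unit_vec N i)" for \<omega> i
  have gc: "g \<omega> = c (r \<omega>) i" if "\<X> (Suc u) \<omega> = unit_vec N i" for \<omega> i
  proof -
    let ?P = "\<lambda>\<omega>'. path u \<omega>' = path u (r \<omega>) \<and> \<X> (Suc u) \<omega>' = unit_vec N i"
    have "?P (SOME \<omega>'. ?P \<omega>')" by (rule someI[of ?P \<omega>]) (simp add: r that)
    then have "path (Suc u) (SOME \<omega>'. ?P \<omega>') = path (Suc u) \<omega>"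
      using that unfolding path_Suc r by simp
    from measurable_filtD[OF g this] show ?thesis unfolding c_def by simp
  qed
  have "\<forall>\<omega>. \<exists>p. fst (snd p) \<in> carrier_vec M \<and> snd (snd p) \<in> carrier_vec (N - M - 1) \<and>
    (\<forall>i<N. c \<omega> i = fst p + integrand N (\<phi>s u \<omega>) (\<phi>' u \<omega>) (fst (snd p)) (snd (snd p)) i)"
    using block_rows_solvable[OF M \<phi>s \<phi>' invertible] by (auto simp: split_paired_Ex)
  then obtain p where p: "\<And>\<omega>. fst (snd (p \<omega>)) \<in> carrier_vec M"
    "\<And>\<omega>. snd (snd (p \<omega>)) \<in> carrier_vec (N - M - 1)"
    "\<And>\<omega> i. i < N \<Longrightarrow> c \<omega> i = fst (p \<omega>)
      + integrand N (\<phi>s u \<omega>) (\<phi>' u \<omega>) (fst (snd (p \<omega>))) (snd (snd (p \<omega>))) i"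
    by metis
  define y where "y \<omega> = fst (p (r \<omega>))" for \<omega>
  define zs where "zs \<omega> = fst (snd (p (r \<omega>)))" for \<omega>
  define z' where "z' \<omega> = snd (snd (p (r \<omega>)))" for \<omega>
  have carrier: "zs \<omega> \<in> carrier_vec M" "z' \<omega> \<in> carrier_vec (N - M - 1)" for \<omega>
    unfolding zs_def z'_def by (rule p)+
  have cong: "y \<omega> = y \<omega>'" "zs \<omega> = zs \<omega>'" "z' \<omega> = z' \<omega>'" if "path u \<omega> = path u \<omega>'" for \<omega> \<omega>'
    unfolding y_def zs_def z'_def r_cong[OF that] by simp_all
  define Ys where "Ys \<omega> = zs \<omega> \<bullet> increment N \<X> \<phi>s u \<omega>" for \<omega>
  define Y' where "Y' \<omega> = z' \<omega> \<bullet> increment N \<X> \<phi>' u \<omega>" for \<omega>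
  \<comment> \<open>The expansion holds for every \<open>i < N\<close>; reading it at the state that
    actually occurs gives the identity at every outcome.\<close>
  have g_eq: "g = (\<lambda>\<omega>. y \<omega> + (Ys \<omega> + Y' \<omega>))"
  proof
    fix \<omega>
    obtain i where i: "i < N" "\<X> (Suc u) \<omega> = unit_vec N i"
      and int: "\<And>zs z'. zs \<bullet> increment N \<X> \<phi>s u \<omega> + z' \<bullet> increment N \<X> \<phi>' u \<omega>
        = integrand N (\<phi>s u \<omega>) (\<phi>' u \<omega>) zs z' i"
      using integrand_eq by blast
    show "g \<omega> = y \<omega> + (Ys \<omega> + Y' \<omega>)"
      unfolding gc[OF i(2)] p(3)[OF i(1)] Ys_def Y'_def int \<phi>_cong[OF r]
      unfolding y_def zs_def z'_def ..
  qed
  have y: "y \<in> borel_measurable (filt \<X> u)" by (rule measurable_filtI) (rule cong)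
  have Ys: "Ys \<in> H"
    unfolding Ys_def
  proof (rule H_filt[OF measurable_filtI])
    fix \<omega> \<omega>' assume "path (Suc u) \<omega> = path (Suc u) \<omega>'"
    then show "zs \<omega> \<bullet> increment N \<X> \<phi>s u \<omega> = zs \<omega>' \<bullet> increment N \<X> \<phi>s u \<omega>'"
      using increment_cong[of u \<omega> \<omega>'] cong(2)[of \<omega> \<omega>'] by (simp add: path_Suc)
  qed
  have Y': "Y' \<in> H"
    unfolding Y'_def
  proof (rule H_filt[OF measurable_filtI])
    fix \<omega> \<omega>' assume "path (Suc u) \<omega> = path (Suc u) \<omega>'"
    then show "z' \<omega> \<bullet> increment N \<X> \<phi>' u \<omega> = z' \<omega>' \<bullet> increment N \<X> \<phi>' u \<omega>'"
      using increment_cong[of u \<omega> \<omega>'] cong(3)[of \<omega> \<omega>'] by (simp add: path_Suc)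
  qed
  define W where "W i \<omega> = increment N \<X> \<phi>s u \<omega> $ i" for i \<omega>
  have dim: "dim_vec (increment N \<X> \<phi>s u \<omega>) = M" for \<omega>
    using \<phi>s[of u \<omega>] unfolding increment_def by simp
  \<comment> \<open>A combination of symmetric martingale differences with coefficients known at
    time \<open>u\<close>, the shape to which \<open>E_add_symmetric\<close> applies.\<close>
  have Ys_sum: "Ys = (\<lambda>\<omega>. \<Sum>i<M. (\<lambda>\<omega>. zs \<omega> $ i) \<omega> * W i \<omega>)"
    unfolding Ys_def W_def scalar_prod_def dim lessThan_atLeast0 by simp
  have incr: "(\<lambda>\<omega>. increment N \<X> \<phi>s v \<omega> $ i) \<in> borel_measurable (filt \<X> (Suc v))" for i v
    by (rule measurable_filtI) (drule increment_cong(1), simp)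
  have "quasi_surely \<X> E (\<lambda>\<omega>. E u (\<lambda>\<omega>. (\<Sum>i<M. (\<lambda>\<omega>. zs \<omega> $ i) \<omega> * W i \<omega>) + Y' \<omega>) \<omega> = E u Y' \<omega>)"
  proof (rule E_add_symmetric[OF _ _ Y'])
    fix i assume i: "i < M"
    show "(\<lambda>\<omega>. zs \<omega> $ i) \<in> borel_measurable (filt \<X> u)"
      by (rule measurable_filtI) (drule cong(2), simp)
    show "W i \<in> H" unfolding W_def by (rule H_filt[OF incr])
    show "quasi_surely \<X> E (\<lambda>\<omega>. E u (W i) \<omega> = 0 \<and> E u (\<lambda>\<omega>. - W i \<omega>) \<omega> = 0)"
      unfolding W_def using incr symmetric[OF i] by (rule symmetric_martingale_increment)
  qed
  then have qs: "quasi_surely \<X> E (\<lambda>\<omega>. E u (\<lambda>\<omega>. Ys \<omega> + Y' \<omega>) \<omega> = E u Y' \<omega>)"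
    unfolding Ys_sum .
  \<comment> \<open>The constant term \<open>y\<close> is known at time \<open>u\<close>, so it
    occurs in both \<open>g\<close> and \<open>E u g\<close> and cancels.\<close>
  have "quasi_surely \<X> E (\<lambda>\<omega>. g \<omega> - E u g \<omega> = Ys \<omega> + Y' \<omega> - E u Y' \<omega>)"
    by (rule quasi_surely_mono[OF qs])
      (use E_translate[OF y H_add[OF Ys Y']] in \<open>simp add: g_eq\<close>)
  then have "quasi_surely \<X> E (\<lambda>\<omega>. g \<omega> - E u g \<omega> = zs \<omega> \<bullet> increment N \<X> \<phi>s u \<omega>
      + z' \<omega> \<bullet> increment N \<X> \<phi>' u \<omega> - driver N \<X> E \<phi>' u z' \<omega>)"
    unfolding driver_def Ys_def Y'_def .
  with carrier cong show ?thesis by (intro exI[of _ zs] exI[of _ z']) blast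
qed

text \<open>With \<open>d i\<close> the difference of the two sides at state \<open>i\<close>,
  \<open>D\<close> dominates |d i| on the event that \<open>i\<close> comes next. Since
  \<open>E u D\<close> vanishes quasi-surely, so does |d i| times the conditional capacity of that
  event, which is positive for a reachable \<open>i\<close>.\<close>

lemma one_step_unique:
  assumes Z: "adapted_vec \<X> M Zs" "adapted_vec \<X> (N - M - 1) Z'"
    and W: "adapted_vec \<X> M Ws" "adapted_vec \<X> (N - M - 1) W'"
    and eq: "quasi_surely \<X> E (\<lambda>\<omega>. summand Zs Z' u \<omega> = summand Ws W' u \<omega>)"
  shows "quasi_surely \<X> E (\<lambda>\<omega>. \<forall>i\<in>next_states N \<X> E u \<omega>.
    integrand N (\<phi>s u \<omega>) (\<phi>' u \<omega>) (Zs u \<omega>) (Z' u \<omega>) i - driver N \<X> E \<phi>' u (Z' u) \<omega>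
    = integrand N (\<phi>s u \<omega>) (\<phi>' u \<omega>) (Ws u \<omega>) (W' u \<omega>) i - driver N \<X> E \<phi>' u (W' u) \<omega>)"
proof -
  define d where "d i \<omega> =
    (integrand N (\<phi>s u \<omega>) (\<phi>' u \<omega>) (Zs u \<omega>) (Z' u \<omega>) i - driver N \<X> E \<phi>' u (Z' u) \<omega>)
    - (integrand N (\<phi>s u \<omega>) (\<phi>' u \<omega>) (Ws u \<omega>) (W' u \<omega>) i - driver N \<X> E \<phi>' u (W' u) \<omega>)" for i \<omega>
  define D where "D \<omega> = \<bar>summand Zs Z' u \<omega> - summand Ws W' u \<omega>\<bar>" for \<omega>
  define A where "A i = {\<omega>'. \<X> (Suc u) \<omega>' = unit_vec N i}" for i
  have D: "D \<in> H"
    unfolding D_def using Z W by (intro H_abs H_diff H_filt[OF summand_measurable])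
  have A: "indicator (A i) \<in> H" for i
  proof -
    have "A i \<in> sets (filt \<X> (Suc u))" unfolding A_def sets_filt_iff path_Suc by simp
    then show ?thesis using sets_filt_subset by (intro H_ind) auto
  qed
  \<comment> \<open>The modulus makes the multiplier non-negative, so that only the first term of
    \<open>E_mult_filt\<close> survives.\<close>
  have d: "(\<lambda>\<omega>. \<bar>d i \<omega>\<bar>) \<in> borel_measurable (filt \<X> u)" for i
  proof (rule measurable_filtI)
    fix \<omega> \<omega>' assume p: "path u \<omega> = path u \<omega>'"
    show "\<bar>d i \<omega>\<bar> = \<bar>d i \<omega>'\<bar>"
      unfolding d_def \<phi>_cong[OF p] adapted_vec_cong[OF Z(1) p] adapted_vec_cong[OF Z(2) p]
        adapted_vec_cong[OF W(1) p] adapted_vec_cong[OF W(2) p]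
        measurable_filtD[OF driver_measurable[OF Z(2)] p]
        measurable_filtD[OF driver_measurable[OF W(2)] p] ..
  qed
  have le: "\<bar>d i \<omega>\<bar> * indicator (A i) \<omega> \<le> D \<omega>" if "i < N" for i \<omega>
  proof (cases "\<omega> \<in> A i")
    case True
    then have "summand Zs Z' u \<omega> - summand Ws W' u \<omega> = d i \<omega>"
      using integrand_cong_unit_vec[of \<X> u \<omega> N i _ \<phi>s _ \<phi>'] that
      by (simp add: A_def d_def summand_def)
    then show ?thesis unfolding D_def by (simp add: indicator_def)
  qed (simp add: D_def)
  have "quasi_surely \<X> E (\<lambda>\<omega>. D \<omega> = 0)"
    using eq by (rule quasi_surely_mono) (simp add: D_def)
  then have "quasi_surely \<X> E (\<lambda>\<omega>. E u D \<omega> = E u (\<lambda>_. 0) \<omega>)"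
    by (intro quasi_surely_E D H_const)
  then show ?thesis
  proof (rule quasi_surely_mono)
    fix \<omega> assume "E u D \<omega> = E u (\<lambda>_. 0) \<omega>"
    then have D0: "E u D \<omega> = 0" by (simp add: E_const)
    have "d i \<omega> = 0" if i: "i \<in> next_states N \<X> E u \<omega>" for i
    proof -
      have "i < N" and pos: "0 < E u (indicator (A i)) \<omega>"
        using i unfolding next_states_def A_def by auto
      have "\<bar>d i \<omega>\<bar> * E u (indicator (A i)) \<omega> = E u (\<lambda>\<omega>. \<bar>d i \<omega>\<bar> * indicator (A i) \<omega>) \<omega>"
        using E_mult_filt[OF d[of i] A[of i], of \<omega>] by simp
      also have "\<dots> \<le> E u D \<omega>"
        using le[OF \<open>i < N\<close>] D A d by (intro E_mono H_mult_filt)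
      finally show ?thesis using pos D0 by (simp add: mult_le_0_iff)
    qed
    then show "\<forall>i\<in>next_states N \<X> E u \<omega>.
      integrand N (\<phi>s u \<omega>) (\<phi>' u \<omega>) (Zs u \<omega>) (Z' u \<omega>) i - driver N \<X> E \<phi>' u (Z' u) \<omega>
      = integrand N (\<phi>s u \<omega>) (\<phi>' u \<omega>) (Ws u \<omega>) (W' u \<omega>) i - driver N \<X> E \<phi>' u (W' u) \<omega>"
      unfolding d_def by simp
  qed
qed

section \<open>Assembling the time steps into existence and uniqueness\<close>

lemma martingale_representation_exists:
  assumes g: "\<And>t. g t \<in> borel_measurable (filt \<X> t)" "\<And>t. X t = L1_of H E (g t)"
    and X: "SL_martingale \<X> H E X"
  shows "\<exists>Zs Z'. represents N M \<X> H E \<phi>s \<phi>' X Zs Z'"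
proof -
  have gH: "g t \<in> H" for t using H_filt[OF g(1)] .
  have mart: "quasi_surely \<X> E (\<lambda>\<omega>. g t \<omega> = E t (g (Suc t)) \<omega>)" for t
  proof -
    have "L1_of H E (g t) = E_L1 H E t (L1_of H E (g (Suc t)))"
      using X unfolding SL_martingale_def g(2) by simp
    then show ?thesis using gH by (simp add: E_L1_of L1_of_eq_iff E_H)
  qed
  have "\<forall>u. \<exists>zs z'. (\<forall>\<omega>. zs \<omega> \<in> carrier_vec M \<and> z' \<omega> \<in> carrier_vec (N - M - 1)) \<and>
    (\<forall>\<omega> \<omega>'. path u \<omega> = path u \<omega>' \<longrightarrow> zs \<omega> = zs \<omega>' \<and> z' \<omega> = z' \<omega>') \<and>
    quasi_surely \<X> E (\<lambda>\<omega>. g (Suc u) \<omega> - E u (g (Suc u)) \<omega> = zs \<omega> \<bullet> increment N \<X> \<phi>s u \<omega>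
      + z' \<omega> \<bullet> increment N \<X> \<phi>' u \<omega> - driver N \<X> E \<phi>' u z' \<omega>)"
    using one_step_exists[OF g(1)] by (rule allI)
  from choice[OF this] obtain Zs where
    "\<forall>u. \<exists>z'. (\<forall>\<omega>. Zs u \<omega> \<in> carrier_vec M \<and> z' \<omega> \<in> carrier_vec (N - M - 1)) \<and>
    (\<forall>\<omega> \<omega>'. path u \<omega> = path u \<omega>' \<longrightarrow> Zs u \<omega> = Zs u \<omega>' \<and> z' \<omega> = z' \<omega>') \<and>
    quasi_surely \<X> E (\<lambda>\<omega>. g (Suc u) \<omega> - E u (g (Suc u)) \<omega> = Zs u \<omega> \<bullet> increment N \<X> \<phi>s u \<omega>
      + z' \<omega> \<bullet> increment N \<X> \<phi>' u \<omega> - driver N \<X> E \<phi>' u z' \<omega>)" ..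
  from choice[OF this] obtain Z' where Z:
    "\<forall>u. (\<forall>\<omega>. Zs u \<omega> \<in> carrier_vec M \<and> Z' u \<omega> \<in> carrier_vec (N - M - 1)) \<and>
    (\<forall>\<omega> \<omega>'. path u \<omega> = path u \<omega>' \<longrightarrow> Zs u \<omega> = Zs u \<omega>' \<and> Z' u \<omega> = Z' u \<omega>') \<and>
    quasi_surely \<X> E (\<lambda>\<omega>. g (Suc u) \<omega> - E u (g (Suc u)) \<omega> = summand Zs Z' u \<omega>)"
    unfolding summand_def ..
  have adapted: "adapted_vec \<X> M Zs" "adapted_vec \<X> (N - M - 1) Z'"
  proof -
    \<comment> \<open>The chosen coefficients depend only on the path up to time \<open>u\<close>,
      which is adaptedness.\<close>
    have "Zs u \<omega> = Zs u \<omega>'" "Z' u \<omega> = Z' u \<omega>'" if "path u \<omega> = path u \<omega>'" for u \<omega> \<omega>'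
      using Z that by blast+
    then have "(\<lambda>\<omega>. Zs u \<omega> $ i) \<in> borel_measurable (filt \<X> u)"
      "(\<lambda>\<omega>. Z' u \<omega> $ i) \<in> borel_measurable (filt \<X> u)" for u i
      by (metis measurable_filtI)+
    then show "adapted_vec \<X> M Zs" "adapted_vec \<X> (N - M - 1) Z'"
      using Z unfolding adapted_vec_def by blast+
  qed
  have step: "quasi_surely \<X> E (\<lambda>\<omega>. g (Suc u) \<omega> - E u (g (Suc u)) \<omega> = summand Zs Z' u \<omega>)" for u
    using Z by blast
  have "quasi_surely \<X> E (\<lambda>\<omega>. g t \<omega> = g 0 \<omega> + (\<Sum>u<t. summand Zs Z' u \<omega>))" for t
  proof (induction t)
    case 0
    show ?case by (rule quasi_surelyI) simp
  next
    case (Suc t)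
    \<comment> \<open>By the martingale property \<open>g t\<close> is quasi-surely
      \<open>E t (g (Suc t))\<close>, so the one-step identity adds the next summand.\<close>
    show ?case
      by (rule quasi_surely_mono[OF quasi_surely_conj[OF Suc quasi_surely_conj[OF mart[of t] step[of t]]]]) simp
  qed
  then show ?thesis using adapted represents_iff[of g X, OF gH g(2)] by blast
qed

lemma martingale_representation_unique:
  assumes g: "\<And>t. g t \<in> H" "\<And>t. X t = L1_of H E (g t)"
    and Z: "represents N M \<X> H E \<phi>s \<phi>' X Zs Z'" and W: "represents N M \<X> H E \<phi>s \<phi>' X Ws W'"
  shows "agree N \<X> E \<phi>s \<phi>' Zs Z' Ws W'"
  unfolding agree_def
proof
  fix u
  have Z': "adapted_vec \<X> M Zs" "adapted_vec \<X> (N - M - 1) Z'"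
      "\<And>t. quasi_surely \<X> E (\<lambda>\<omega>. g t \<omega> = g 0 \<omega> + (\<Sum>u<t. summand Zs Z' u \<omega>))"
    using Z unfolding represents_iff[of g X, OF g] by auto
  have W': "adapted_vec \<X> M Ws" "adapted_vec \<X> (N - M - 1) W'"
      "\<And>t. quasi_surely \<X> E (\<lambda>\<omega>. g t \<omega> = g 0 \<omega> + (\<Sum>u<t. summand Ws W' u \<omega>))"
    using W unfolding represents_iff[of g X, OF g] by auto
  \<comment> \<open>Subtracting the representations at time \<open>u\<close> from those at time
    \<open>Suc u\<close> isolates the summand at \<open>u\<close>.\<close>
  have "quasi_surely \<X> E (\<lambda>\<omega>. summand Zs Z' u \<omega> = summand Ws W' u \<omega>)"
    by (rule quasi_surely_mono[OF quasi_surely_conj[OF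
      quasi_surely_conj[OF Z'(3)[of u] W'(3)[of u]]
      quasi_surely_conj[OF Z'(3)[of "Suc u"] W'(3)[of "Suc u"]]]]) simp
  from one_step_unique[OF Z'(1,2) W'(1,2) this]
  show "quasi_surely \<X> E (\<lambda>\<omega>.
     (next_states N \<X> E u \<omega> = {..<N} \<longrightarrow> Zs u \<omega> = Ws u \<omega> \<and> Z' u \<omega> = W' u \<omega>) \<and>
     (\<forall>i\<in>next_states N \<X> E u \<omega>. \<forall>j\<in>next_states N \<X> E u \<omega>.
        integrand N (\<phi>s u \<omega>) (\<phi>' u \<omega>) (Zs u \<omega>) (Z' u \<omega>) i
          - integrand N (\<phi>s u \<omega>) (\<phi>' u \<omega>) (Zs u \<omega>) (Z' u \<omega>) j
        = integrand N (\<phi>s u \<omega>) (\<phi>' u \<omega>) (Ws u \<omega>) (W' u \<omega>) i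
          - integrand N (\<phi>s u \<omega>) (\<phi>' u \<omega>) (Ws u \<omega>) (W' u \<omega>) j))"
  proof (rule quasi_surely_mono, intro conjI impI ballI)
    fix \<omega>
    assume eq: "\<forall>i\<in>next_states N \<X> E u \<omega>.
      integrand N (\<phi>s u \<omega>) (\<phi>' u \<omega>) (Zs u \<omega>) (Z' u \<omega>) i - driver N \<X> E \<phi>' u (Z' u) \<omega>
      = integrand N (\<phi>s u \<omega>) (\<phi>' u \<omega>) (Ws u \<omega>) (W' u \<omega>) i - driver N \<X> E \<phi>' u (W' u) \<omega>"
    {
      assume "next_states N \<X> E u \<omega> = {..<N}"
      \<comment> \<open>The negated drivers play the part of the constants in
        \<open>block_rows_unique\<close>.\<close>
      then have "- driver N \<X> E \<phi>' u (Z' u) \<omega> + integrand N (\<phi>s u \<omega>) (\<phi>' u \<omega>) (Zs u \<omega>) (Z' u \<omega>) i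
        = - driver N \<X> E \<phi>' u (W' u) \<omega> + integrand N (\<phi>s u \<omega>) (\<phi>' u \<omega>) (Ws u \<omega>) (W' u \<omega>) i"
        if "i < N" for i using eq that by simp
      from block_rows_unique[OF M \<phi>s \<phi>' invertible _ _ _ _ this] Z'(1,2) W'(1,2)
      have "Zs u \<omega> = Ws u \<omega> \<and> Z' u \<omega> = W' u \<omega>" unfolding adapted_vec_def by blast
      then show "Zs u \<omega> = Ws u \<omega>" "Z' u \<omega> = W' u \<omega>" by auto
    next
      \<comment> \<open>The drivers do not depend on the state, so they cancel between the equations
        for \<open>i\<close> and \<open>j\<close>.\<close>
      fix i j assume "i \<in> next_states N \<X> E u \<omega>" "j \<in> next_states N \<X> E u \<omega>"
      with eq[rule_format, of i] eq[rule_format, of j]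
      show "integrand N (\<phi>s u \<omega>) (\<phi>' u \<omega>) (Zs u \<omega>) (Z' u \<omega>) i
          - integrand N (\<phi>s u \<omega>) (\<phi>' u \<omega>) (Zs u \<omega>) (Z' u \<omega>) j
        = integrand N (\<phi>s u \<omega>) (\<phi>' u \<omega>) (Ws u \<omega>) (W' u \<omega>) i
          - integrand N (\<phi>s u \<omega>) (\<phi>' u \<omega>) (Ws u \<omega>) (W' u \<omega>) j" by linarith
    }
  qed
qed

end

theorem theorem5p2:
  fixes N M :: nat
    and \<X> :: "nat \<Rightarrow> 'w \<Rightarrow> real vec"
    and H :: "('w \<Rightarrow> real) set"
    and E :: "nat \<Rightarrow> ('w \<Rightarrow> real) \<Rightarrow> 'w \<Rightarrow> real"
    and \<Phi> \<phi>s \<phi>' :: "nat \<Rightarrow> 'w \<Rightarrow> real mat"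
    and X :: "nat \<Rightarrow> 'w L1_class"
  assumes SL: "SL_expectation N \<X> H E"
    and M: "M < N"
    and \<phi>s: "\<And>u \<omega>. \<phi>s u \<omega> \<in> carrier_mat M N"
    and \<phi>': "\<And>u \<omega>. \<phi>' u \<omega> \<in> carrier_mat (N - M - 1) N"
    and \<Phi>: "\<And>u \<omega>. \<Phi> u \<omega> = mat_of_row (vec N (\<lambda>_. 1)) @\<^sub>r \<phi>s u \<omega> @\<^sub>r \<phi>' u \<omega>"
    and \<Phi>_adapted: "adapted_mat \<X> N N \<Phi>"
    and \<Phi>_invertible: "\<And>u \<omega>. invertible_mat (\<Phi> u \<omega>)"
    and symmetric: "\<And>i. i < M \<Longrightarrow> symmetric_SL_martingale \<X> H E
          (\<lambda>t. L1_of H E (\<lambda>\<omega>. \<Sum>u<t. increment N \<X> \<phi>s u \<omega> $ i))"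
    and martingale: "SL_martingale \<X> H E X"
  shows "(\<exists>Zs Z'. represents N M \<X> H E \<phi>s \<phi>' X Zs Z') \<and>
    (\<forall>Zs Z' Ws W'. represents N M \<X> H E \<phi>s \<phi>' X Zs Z' \<longrightarrow> represents N M \<X> H E \<phi>s \<phi>' X Ws W' \<longrightarrow>
       agree N \<X> E \<phi>s \<phi>' Zs Z' Ws W')"
proof -
  interpret SL_basis N \<X> H E M \<phi>s \<phi>'
  proof (intro SL_basis.intro SL SL_basis_axioms.intro M \<phi>s \<phi>' symmetric)
    show "adapted_mat \<X> N N (\<lambda>u \<omega>. mat_of_row (vec N (\<lambda>_. 1)) @\<^sub>r \<phi>s u \<omega> @\<^sub>r \<phi>' u \<omega>)"
      using \<Phi>_adapted unfolding adapted_mat_def \<Phi> .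
    show "invertible_mat (mat_of_row (vec N (\<lambda>_. 1)) @\<^sub>r \<phi>s u \<omega> @\<^sub>r \<phi>' u \<omega>)" for u \<omega>
      using \<Phi>_invertible[of u \<omega>] unfolding \<Phi> .
  qed
  \<comment> \<open>Each class \<open>X t\<close> is replaced by a real-valued version depending
    only on the path up to time \<open>t\<close>; both halves of the claim work with these
    versions.\<close>
  have "\<exists>g. g \<in> borel_measurable (filt \<X> t) \<and> X t = L1_of H E g" for t
  proof -
    have "X t \<in> L1_measurable \<X> H E t" using martingale unfolding SL_martingale_def by simp
    then show ?thesis by (rule L1_measurableE) blast
  qed
  then have "\<forall>t. \<exists>g. g \<in> borel_measurable (filt \<X> t) \<and> X t = L1_of H E g" by (rule allI)
  from choice[OF this] obtain g
    where g: "\<And>t. g t \<in> borel_measurable (filt \<X> t)" "\<And>t. X t = L1_of H E (g t)" by auto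
  show ?thesis
  proof (intro conjI allI impI)
    show "\<exists>Zs Z'. represents N M \<X> H E \<phi>s \<phi>' X Zs Z'"
      using g martingale by (rule martingale_representation_exists)
    show "agree N \<X> E \<phi>s \<phi>' Zs Z' Ws W'"
      if "represents N M \<X> H E \<phi>s \<phi>' X Zs Z'" "represents N M \<X> H E \<phi>s \<phi>' X Ws W'"
      for Zs Z' Ws W'
      by (rule martingale_representation_unique[of g X, OF H_filt[OF g(1)] g(2) that])
  qed
qed

end
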